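(* Let $F,G:\mathcal{K}\to\mathcal{L}$ be strongly class-accessible functors and let $\varphi,\psi:F\to G$ be natural transformations. Then the equifier $\operatorname{Eq}(\varphi,\psi)$ is a class-accessible category strongly accessibly embedded in $\mathcal{K}$.
   Context: Sets and classes are distinguished (Gödel–Bernays set theory); a category may have a proper class of objects but has hom-sets between any two objects. Colimits are small. For a regular cardinal $\lambda$, an object $K$ of a category $\mathcal{K}$ is $\lambda$-presentable if $\hom(K,-):\mathcal{K}\to\mathbf{Set}$ preserves $\lambda$-filtered colimits. $\mathcal{K}$ is class-$\lambda$-accessible if it has $\lambda$-filtered colimits and there is a class $\mathcal{A}$ of $\lambda$-presentable objects of $\mathcal{K}$ such that every object of $\mathcal{K}$ is a $\lambda$-filtered colimit of objects from $\mathcal{A}$; it is class-accessible if it is class-$\lambda$-accessible for some regular cardinal $\lambda$. A functor $F:\mathcal{K}\to\mathcal{L}$ is class-$\lambda$-accessible if $\mathcal{K}$ and $\mathcal{L}$ are class-$\lambda$-accessible and $F$ preserves $\lambda$-filtered colimits; it is strongly class-$\lambda$-accessible if moreover it preserves $\lambda$-presentable objects. $F$ is strongly class-accessible if it is strongly class-$\lambda$-accessible for some regular cardinal $\lambda$. A full subcategory $\mathcal{L}$ of $\mathcal{K}$ is strongly accessibly embedded if there is a regular cardinal $\lambda$ such that $\mathcal{L}$ is closed under $\lambda$-filtered colimits in $\mathcal{K}$ and the inclusion of $\mathcal{L}$ into $\mathcal{K}$ preserves $\lambda$-presentable objects. The equifier $\operatorname{Eq}(\varphi,\psi)$ is the full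 subcategory of $\mathcal{K}$ consisting of all objects $K$ such that $\varphi_K=\psi_K$. *)

theory Defs
  imports Main "HOL-Library.FuncSet"
begin

unbundle cardinal_syntax

text \<open>
  Goedel--Bernays set theory is modelled by a type \<open>'u\<close>, the class of all sets, whose cardinality
  is an (uncountable, strongly) inaccessible cardinal. Classes are the subsets of the type, i.e. the
  inhabitants of \<open>'u set\<close>; a class is a set iff it is not equipotent to the class of all sets.
  Inaccessibility says that the sets are closed under the usual set-theoretic constructions: infinity,
  replacement and union (uncountability and regularity), and power sets (strong limit).
\<close>

definition small :: "'u set \<Rightarrow> bool" where
  "small X \<longleftrightarrow> |X| <o |UNIV :: 'u set|"

definition inaccessible :: "'u rel \<Rightarrow> bool" where
  "inaccessible r \<longleftrightarrow>
     Card_order r \<and> natLeq <o r \<and> regularCard r \<and>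
     (\<forall>X :: 'u set. |X| <o r \<longrightarrow> |Pow X| <o r)"

text \<open>A regular cardinal is a set; up to order isomorphism, all of them live on \<open>'u\<close>.\<close>

definition regular_cardinal :: "'u rel \<Rightarrow> bool" where
  "regular_cardinal \<kappa> \<longleftrightarrow> Cinfinite \<kappa> \<and> regularCard \<kappa> \<and> \<kappa> <o |UNIV :: 'u set|"

record ('o, 'm) cat =
  Obj :: "'o set"
  Mor :: "'m set"
  Dom :: "'m \<Rightarrow> 'o"
  Cod :: "'m \<Rightarrow> 'o"
  Id :: "'o \<Rightarrow> 'm"
  Comp :: "'m \<Rightarrow> 'm \<Rightarrow> 'm"

text \<open>\<open>Comp C g f\<close> is the composite \<open>g \<circ> f\<close>.\<close>

definition hom :: "('o, 'm) cat \<Rightarrow> 'o \<Rightarrow> 'o \<Rightarrow> 'm set" where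
  "hom C A B = {f \<in> Mor C. Dom C f = A \<and> Cod C f = B}"

definition category :: "('o, 'm) cat \<Rightarrow> bool" where
  "category C \<longleftrightarrow>
     (\<forall>f \<in> Mor C. Dom C f \<in> Obj C \<and> Cod C f \<in> Obj C) \<and>
     (\<forall>A \<in> Obj C. Id C A \<in> hom C A A) \<and>
     (\<forall>f \<in> Mor C. \<forall>g \<in> Mor C. Cod C f = Dom C g \<longrightarrow> Comp C g f \<in> hom C (Dom C f) (Cod C g)) \<and>
     (\<forall>f \<in> Mor C. Comp C f (Id C (Dom C f)) = f \<and> Comp C (Id C (Cod C f)) f = f) \<and>
     (\<forall>f \<in> Mor C. \<forall>g \<in> Mor C. \<forall>h \<in> Mor C. Cod C f = Dom C g \<longrightarrow> Cod C g = Dom C h \<longrightarrow>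
        Comp C h (Comp C g f) = Comp C (Comp C h g) f)"

text \<open>
  The categories of the theory: a class of objects, a class of morphisms, and hom-sets. Both classes
  are subclasses of the universe.
\<close>

definition class_category :: "('u, 'u) cat \<Rightarrow> bool" where
  "class_category C \<longleftrightarrow> category C \<and> (\<forall>A \<in> Obj C. \<forall>B \<in> Obj C. small (hom C A B))"

definition small_category :: "('u, 'u) cat \<Rightarrow> bool" where
  "small_category C \<longleftrightarrow> category C \<and> small (Obj C) \<and> small (Mor C)"

record ('o, 'm, 'p, 'n) func =
  on_obj :: "'o \<Rightarrow> 'p"
  on_mor :: "'m \<Rightarrow> 'n"

definition is_functor :: "('o, 'm) cat \<Rightarrow> ('p, 'n) cat \<Rightarrow> ('o, 'm, 'p, 'n) func \<Rightarrow> bool" where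
  "is_functor C D F \<longleftrightarrow>
     category C \<and> category D \<and>
     (\<forall>A \<in> Obj C. on_obj F A \<in> Obj D) \<and>
     (\<forall>f \<in> Mor C. on_mor F f \<in> hom D (on_obj F (Dom C f)) (on_obj F (Cod C f))) \<and>
     (\<forall>A \<in> Obj C. on_mor F (Id C A) = Id D (on_obj F A)) \<and>
     (\<forall>f \<in> Mor C. \<forall>g \<in> Mor C. Cod C f = Dom C g \<longrightarrow>
        on_mor F (Comp C g f) = Comp D (on_mor F g) (on_mor F f))"

definition comp_func :: "('p, 'n, 'q, 'k) func \<Rightarrow> ('o, 'm, 'p, 'n) func \<Rightarrow> ('o, 'm, 'q, 'k) func" where
  "comp_func G F = \<lparr>on_obj = on_obj G \<circ> on_obj F, on_mor = on_mor G \<circ> on_mor F\<rparr>"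

definition natural_transformation ::
    "('o, 'm) cat \<Rightarrow> ('p, 'n) cat \<Rightarrow> ('o, 'm, 'p, 'n) func \<Rightarrow> ('o, 'm, 'p, 'n) func \<Rightarrow> ('o \<Rightarrow> 'n) \<Rightarrow> bool" where
  "natural_transformation C D F G \<phi> \<longleftrightarrow>
     is_functor C D F \<and> is_functor C D G \<and>
     (\<forall>A \<in> Obj C. \<phi> A \<in> hom D (on_obj F A) (on_obj G A)) \<and>
     (\<forall>f \<in> Mor C. Comp D (\<phi> (Cod C f)) (on_mor F f) = Comp D (on_mor G f) (\<phi> (Dom C f)))"

definition full_subcategory :: "('o, 'm) cat \<Rightarrow> 'o set \<Rightarrow> ('o, 'm) cat" where
  "full_subcategory C S =
     C\<lparr>Obj := {A \<in> Obj C. A \<in> S}, Mor := {f \<in> Mor C. Dom C f \<in> S \<and> Cod C f \<in> S}\<rparr>"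

definition is_full_subcategory :: "('o, 'm) cat \<Rightarrow> ('o, 'm) cat \<Rightarrow> bool" where
  "is_full_subcategory L K \<longleftrightarrow> (\<exists>S \<subseteq> Obj K. L = full_subcategory K S)"

definition inclusion :: "('o, 'm, 'o, 'm) func" where
  "inclusion = \<lparr>on_obj = (\<lambda>A. A), on_mor = (\<lambda>f. f)\<rparr>"

text \<open>The category of sets. A morphism carries its domain and codomain; its underlying function is
  extensional, so that equality of morphisms is pointwise equality on the domain.\<close>

type_synonym 'u set_mor = "'u set \<times> ('u \<Rightarrow> 'u) \<times> 'u set"

definition Set_cat :: "('u set, 'u set_mor) cat" where
  "Set_cat =
     \<lparr>Obj = {X. small X},
      Mor = {(X, f, Y). small X \<and> small Y \<and> f \<in> X \<rightarrow>\<^sub>E Y},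
      Dom = (\<lambda>(X, f, Y). X),
      Cod = (\<lambda>(X, f, Y). Y),
      Id = (\<lambda>X. (X, restrict (\<lambda>x. x) X, X)),
      Comp = (\<lambda>(Y', g, Z) (X, f, Y). (X, compose X g f, Z))\<rparr>"

definition hom_func :: "('u, 'u) cat \<Rightarrow> 'u \<Rightarrow> ('u, 'u, 'u set, 'u set_mor) func" where
  "hom_func C A =
     \<lparr>on_obj = (\<lambda>B. hom C A B),
      on_mor = (\<lambda>f. (hom C A (Dom C f), restrict (\<lambda>g. Comp C f g) (hom C A (Dom C f)), hom C A (Cod C f)))\<rparr>"

definition is_cocone ::
    "('i, 'j) cat \<Rightarrow> ('o, 'm) cat \<Rightarrow> ('i, 'j, 'o, 'm) func \<Rightarrow> 'o \<Rightarrow> ('i \<Rightarrow> 'm) \<Rightarrow> bool" where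
  "is_cocone I C D A c \<longleftrightarrow>
     A \<in> Obj C \<and>
     (\<forall>i \<in> Obj I. c i \<in> hom C (on_obj D i) A) \<and>
     (\<forall>f \<in> Mor I. Comp C (c (Cod I f)) (on_mor D f) = c (Dom I f))"

definition is_colimit ::
    "('i, 'j) cat \<Rightarrow> ('o, 'm) cat \<Rightarrow> ('i, 'j, 'o, 'm) func \<Rightarrow> 'o \<Rightarrow> ('i \<Rightarrow> 'm) \<Rightarrow> bool" where
  "is_colimit I C D A c \<longleftrightarrow>
     is_cocone I C D A c \<and>
     (\<forall>B d. is_cocone I C D B d \<longrightarrow> (\<exists>!u. u \<in> hom C A B \<and> (\<forall>i \<in> Obj I. Comp C u (c i) = d i)))"

text \<open>The shapes \<open>J\<close> may be taken on \<open>'u\<close>: when \<open>\<kappa>\<close> is a regular cardinal in the above sense, every category with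
  fewer than \<open>\<kappa>\<close> morphisms is isomorphic to one there.\<close>

definition filtered :: "'u rel \<Rightarrow> ('u, 'u) cat \<Rightarrow> bool" where
  "filtered \<kappa> I \<longleftrightarrow>
     category I \<and>
     (\<forall>(J :: ('u, 'u) cat) D. is_functor J I D \<and> |Mor J| <o \<kappa> \<longrightarrow> (\<exists>A c. is_cocone J I D A c))"

definition filtered_diagram :: "'u rel \<Rightarrow> ('u, 'u) cat \<Rightarrow> ('u, 'u) cat \<Rightarrow> ('u, 'u, 'u, 'u) func \<Rightarrow> bool" where
  "filtered_diagram \<kappa> I C D \<longleftrightarrow> small_category I \<and> filtered \<kappa> I \<and> is_functor I C D"

definition has_filtered_colimits :: "'u rel \<Rightarrow> ('u, 'u) cat \<Rightarrow> bool" where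
  "has_filtered_colimits \<kappa> C \<longleftrightarrow>
     (\<forall>I D. filtered_diagram \<kappa> I C D \<longrightarrow> (\<exists>A c. is_colimit I C D A c))"

definition preserves_filtered_colimits ::
    "'u rel \<Rightarrow> ('u, 'u) cat \<Rightarrow> ('p, 'n) cat \<Rightarrow> ('u, 'u, 'p, 'n) func \<Rightarrow> bool" where
  "preserves_filtered_colimits \<kappa> C E F \<longleftrightarrow>
     (\<forall>I D A c. filtered_diagram \<kappa> I C D \<and> is_colimit I C D A c \<longrightarrow>
        is_colimit I E (comp_func F D) (on_obj F A) (\<lambda>i. on_mor F (c i)))"

definition closed_under_filtered_colimits :: "'u rel \<Rightarrow> ('u, 'u) cat \<Rightarrow> ('u, 'u) cat \<Rightarrow> bool" where
  "closed_under_filtered_colimits \<kappa> L K \<longleftrightarrow>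
     (\<forall>I D A c. filtered_diagram \<kappa> I L D \<and> is_colimit I K (comp_func inclusion D) A c \<longrightarrow> A \<in> Obj L)"

definition presentable :: "'u rel \<Rightarrow> ('u, 'u) cat \<Rightarrow> 'u \<Rightarrow> bool" where
  "presentable \<kappa> C A \<longleftrightarrow> A \<in> Obj C \<and> preserves_filtered_colimits \<kappa> C Set_cat (hom_func C A)"

definition class_accessible_at :: "'u rel \<Rightarrow> ('u, 'u) cat \<Rightarrow> bool" where
  "class_accessible_at \<kappa> C \<longleftrightarrow>
     class_category C \<and> has_filtered_colimits \<kappa> C \<and>
     (\<exists>\<A>. (\<forall>A \<in> \<A>. presentable \<kappa> C A) \<and>
        (\<forall>K \<in> Obj C. \<exists>I D c. filtered_diagram \<kappa> I C D \<and> (\<forall>i \<in> Obj I. on_obj D i \<in> \<A>) \<and>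
           is_colimit I C D K c))"

definition class_accessible :: "('u, 'u) cat \<Rightarrow> bool" where
  "class_accessible C \<longleftrightarrow> (\<exists>\<kappa>. regular_cardinal \<kappa> \<and> class_accessible_at \<kappa> C)"

definition preserves_presentable ::
    "'u rel \<Rightarrow> ('u, 'u) cat \<Rightarrow> ('u, 'u) cat \<Rightarrow> ('u, 'u, 'u, 'u) func \<Rightarrow> bool" where
  "preserves_presentable \<kappa> C E F \<longleftrightarrow> (\<forall>A. presentable \<kappa> C A \<longrightarrow> presentable \<kappa> E (on_obj F A))"

definition class_accessible_functor_at ::
    "'u rel \<Rightarrow> ('u, 'u) cat \<Rightarrow> ('u, 'u) cat \<Rightarrow> ('u, 'u, 'u, 'u) func \<Rightarrow> bool" where
  "class_accessible_functor_at \<kappa> K L F \<longleftrightarrow>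
     is_functor K L F \<and> class_accessible_at \<kappa> K \<and> class_accessible_at \<kappa> L \<and>
     preserves_filtered_colimits \<kappa> K L F"

definition strongly_class_accessible_functor_at ::
    "'u rel \<Rightarrow> ('u, 'u) cat \<Rightarrow> ('u, 'u) cat \<Rightarrow> ('u, 'u, 'u, 'u) func \<Rightarrow> bool" where
  "strongly_class_accessible_functor_at \<kappa> K L F \<longleftrightarrow>
     class_accessible_functor_at \<kappa> K L F \<and> preserves_presentable \<kappa> K L F"

definition strongly_class_accessible_functor ::
    "('u, 'u) cat \<Rightarrow> ('u, 'u) cat \<Rightarrow> ('u, 'u, 'u, 'u) func \<Rightarrow> bool" where
  "strongly_class_accessible_functor K L F \<longleftrightarrow>
     (\<exists>\<kappa>. regular_cardinal \<kappa> \<and> strongly_class_accessible_functor_at \<kappa> K L F)"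

definition strongly_accessibly_embedded :: "('u, 'u) cat \<Rightarrow> ('u, 'u) cat \<Rightarrow> bool" where
  "strongly_accessibly_embedded L K \<longleftrightarrow>
     is_full_subcategory L K \<and>
     (\<exists>\<kappa>. regular_cardinal \<kappa> \<and> closed_under_filtered_colimits \<kappa> L K \<and>
        preserves_presentable \<kappa> L K inclusion)"

definition equifier :: "('o, 'm) cat \<Rightarrow> ('o \<Rightarrow> 'n) \<Rightarrow> ('o \<Rightarrow> 'n) \<Rightarrow> ('o, 'm) cat" where
  "equifier K \<phi> \<psi> = full_subcategory K {A \<in> Obj K. \<phi> A = \<psi> A}"

end

theory Submission
  imports Defs
begin

text \<open>
  Let \<open>F\<close> be strongly class-\<open>\<kappa>\<close>-accessible and let \<open>G\<close> preserve \<open>\<kappa>'\<close>-filtered colimits. The equifier is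
  closed under \<open>\<kappa>\<close>-filtered colimits in \<open>K\<close>: if \<open>\<phi>\<close> and \<open>\<psi>\<close> agree on the objects of a diagram with colimit
  \<open>c\<^sub>i : D i \<rightarrow> A\<close>, then by naturality \<open>\<phi>\<^sub>A\<close> and \<open>\<psi>\<^sub>A\<close> agree after composition with every \<open>F c\<^sub>i\<close>, and these are
  jointly epic because \<open>F\<close> preserves the colimit. The substance is that every object \<open>X\<close> of the
  equifier is a highly filtered colimit of presentable objects \<^emph>\<open>that lie in the equifier\<close>.

  Suppose that \<open>X\<close> is a \<open>\<mu>\<close>-filtered colimit of objects \<open>D i\<close> of \<open>K\<close> for which \<open>F (D i)\<close> is
  \<open>\<mu>\<close>-presentable, and that \<open>G\<close> preserves this colimit. As \<open>\<phi>\<^sub>X = \<psi>\<^sub>X\<close>, the two morphisms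
  \<open>\<phi>, \<psi> : F (D i) \<rightarrow> G (D i)\<close> become equal in \<open>G X\<close>, hence already at a later stage \<open>G (D j)\<close> along some
  \<open>u\<^sub>i : i \<rightarrow> j\<close>. A \<open>\<mu>\<close>-filtered subdiagram that contains \<open>u\<^sub>i\<close> whenever it contains \<open>i\<close> therefore has its
  colimit in the equifier. If \<open>\<nu>\<close> is sufficiently larger than \<open>\<mu>\<close>, then any fewer than \<open>\<nu>\<close> arrows of the
  index category lie in such a subdiagram with fewer than \<open>\<nu>\<close> arrows, so the colimits of these
  subdiagrams form a \<open>\<nu>\<close>-filtered diagram with colimit \<open>X\<close>. They are \<open>\<nu>\<close>-presentable, being colimits of
  fewer than \<open>\<nu>\<close> presentable objects.

  Passing from a filtered diagram to the diagram of the colimits of its small saturated subdiagrams is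
  \<open>refine_filtered_colimit\<close>. It is applied twice: from \<open>\<kappa>\<close> to some \<open>\<mu> > \<kappa>'\<close>, to bring \<open>F\<close> and \<open>G\<close> to a common
  cardinal, and from \<open>\<mu>\<close> to \<open>\<nu>\<close> with the arrows \<open>u\<^sub>i\<close> as above. It rests on cardinal arithmetic
  (\<open>exists_sharply_above\<close>, \<open>exists_closed_superset\<close>), and \<open>presentable_small_colimit\<close> supplies presentability.

  Presentability in the equifier and in \<open>K\<close> then agree at \<open>\<nu>\<close>. \<open>\<nu>\<close>-filtered colimits in the equifier
  are colimits in \<open>K\<close>, so presentability in \<open>K\<close> descends. Conversely, an object presentable in the equifier is a retract of
  one of the \<open>K\<close>-presentable objects of which it is the colimit.
\<close>

section \<open>Sharply smaller cardinals\<close>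

text \<open>
  A condition of cardinal arithmetic that implies the relation \<open>\<kappa> \<lhd> \<mu>\<close> of Makkai and Pare. The latter only
  asks for a cofinal family of fewer than \<open>\<mu>\<close> such subsets \<open>X\<close>; bounding all of them lets a closure under
  operations of arity less than \<open>\<kappa>\<close> be built by plain iteration.
\<close>

definition sharply_below :: "'u rel \<Rightarrow> 'u rel \<Rightarrow> bool" where
  "sharply_below \<kappa> \<mu> \<longleftrightarrow>
     \<kappa> <o \<mu> \<and> (\<forall>M :: 'u set. |M| <o \<mu> \<longrightarrow> |{X. X \<subseteq> M \<and> |X| <o \<kappa>}| <o \<mu>)"

lemma regular_cardinalD:
  fixes \<kappa> :: "'u rel"
  assumes "regular_cardinal \<kappa>"
  shows "Cinfinite \<kappa>" "Card_order \<kappa>" "infinite (Field \<kappa>)" "regularCard \<kappa>" "|Field \<kappa>| =o \<kappa>"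
    "|Field \<kappa>| <o |UNIV :: 'u set|"
proof -
  show *: "Cinfinite \<kappa>" "Card_order \<kappa>" "infinite (Field \<kappa>)" "regularCard \<kappa>" "|Field \<kappa>| =o \<kappa>"
    using assms by (auto simp: regular_cardinal_def cinfinite_def card_of_Field_ordIso)
  show "|Field \<kappa>| <o |UNIV :: 'u set|"
    by (rule ordIso_ordLess_trans[OF *(5)]) (use assms in \<open>simp add: regular_cardinal_def\<close>)
qed

lemma infinite_UNIV_if_Cinfinite: "Cinfinite (\<kappa> :: 'u rel) \<Longrightarrow> infinite (UNIV :: 'u set)"
  unfolding cinfinite_def using finite_subset[OF subset_UNIV, of "Field \<kappa>"] by blast

lemma exists_pairing:
  assumes "infinite (UNIV :: 'u set)"
  shows "\<exists>p :: 'u \<times> 'u \<Rightarrow> 'u. inj p"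
  using card_of_Times_same_infinite[OF assms]
    card_of_ordIso[of "UNIV \<times> UNIV :: ('u \<times> 'u) set" "UNIV :: 'u set"]
  by (auto simp: bij_betw_def)

lemma exists_tagging:
  assumes inf: "infinite (UNIV :: 'u set)"
  shows "\<exists>e :: nat \<times> 'u \<Rightarrow> 'u. inj e"
proof -
  obtain n :: "nat \<Rightarrow> 'u" where n: "inj n" using infinite_countable_subset[OF inf] by auto
  obtain p :: "'u \<times> 'u \<Rightarrow> 'u" where p: "inj p" using exists_pairing[OF inf] by blast
  have "inj (\<lambda>(k, x). p (n k, x))" by (rule injI) (auto simp: inj_eq[OF n] inj_eq[OF p])
  then show ?thesis by blast
qed

lemma finite_less_Cinfinite:
  assumes "Cinfinite \<kappa>" "finite X"
  shows "|X| <o \<kappa>"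
  using assms by (intro Cfinite_ordLess_Cinfinite) (auto simp: cfinite_def Field_card_of card_of_card_order_on)

lemma Times_less_regular:
  assumes "Cinfinite r" "regularCard r" "|A| <o r" "|B| <o r"
  shows "|A \<times> B| <o r"
proof -
  have "|Pair a ` B| <o r" for a :: 'b using assms(4) card_of_image ordLeq_ordLess_trans by blast
  then have "|\<Union>a \<in> A. Pair a ` B| <o r" by (intro regularCard_UNION_bound assms(1-3))
  moreover have "(\<Union>a \<in> A. Pair a ` B) = A \<times> B" by auto
  ultimately show ?thesis by simp
qed

lemma small_subset: "small Y \<Longrightarrow> X \<subseteq> Y \<Longrightarrow> small X"
  unfolding small_def using card_of_mono1 ordLeq_ordLess_trans by blast

text \<open>
  Close \<open>M0\<close> under \<open>H\<close> by a transfinite iteration of length \<open>\<kappa>\<close>. Each stage stays below \<open>\<mu>\<close>, because a set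
  of size less than \<open>\<mu>\<close> has fewer than \<open>\<mu>\<close> subsets to which \<open>H\<close> is applied and \<open>\<mu>\<close> is regular. The iteration
  is complete after \<open>\<kappa>\<close> steps, because by regularity of \<open>\<kappa>\<close> fewer than \<open>\<kappa>\<close> elements already appear at one
  stage.
\<close>

lemma exists_closed_superset:
  fixes \<kappa> \<mu> :: "'u rel" and H :: "'u set \<Rightarrow> 'u set"
  assumes \<kappa>: "regular_cardinal \<kappa>" and \<mu>: "regular_cardinal \<mu>" and sharp: "sharply_below \<kappa> \<mu>"
    and M0: "|M0| <o \<mu>" and H: "\<And>X. |X| <o \<kappa> \<Longrightarrow> |H X| <o \<mu>"
  shows "\<exists>M. M0 \<subseteq> M \<and> |M| <o \<mu> \<and> (\<forall>X. X \<subseteq> M \<longrightarrow> |X| <o \<kappa> \<longrightarrow> H X \<subseteq> M)"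
proof -
  note regular_cardinalD[OF \<kappa>] and regular_cardinalD[OF \<mu>]
  define step where "step N = N \<union> (\<Union>X \<in> {X. X \<subseteq> N \<and> |X| <o \<kappa>}. H X)" for N
  define stage where
    "stage = wfrec (\<kappa> - Relation.Id) (\<lambda>f a. M0 \<union> (\<Union>b \<in> underS \<kappa> a. step (f b)))"
  have wo: "Well_order \<kappa>" using \<open>Card_order \<kappa>\<close> by (simp add: card_order_on_def)
  then have wf: "wf (\<kappa> - Relation.Id)" by (simp add: well_order_on_def)
  have stage: "stage a = M0 \<union> (\<Union>b \<in> underS \<kappa> a. step (stage b))" for a
  proof -
    have "stage a = M0 \<union> (\<Union>b \<in> underS \<kappa> a. step (cut stage (\<kappa> - Relation.Id) a b))"
      by (rule def_wfrec[OF _ wf, THEN trans]) (simp_all add: stage_def)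
    also have "(\<Union>b \<in> underS \<kappa> a. step (cut stage (\<kappa> - Relation.Id) a b)) = (\<Union>b \<in> underS \<kappa> a. step (stage b))"
      by (rule SUP_cong) (auto simp: underS_def cut_apply)
    finally show ?thesis .
  qed
  define M where "M = (\<Union>a \<in> Field \<kappa>. stage a)"
  have "\<kappa> <o \<mu>" using sharp by (simp add: sharply_below_def)
  then have Field_small: "|Field \<kappa>| <o \<mu>"
    using \<open>|Field \<kappa>| =o \<kappa>\<close> ordIso_ordLess_trans by blast
  have step_small: "|step N| <o \<mu>" if N: "|N| <o \<mu>" for N
  proof -
    have "|\<Union>X \<in> {X. X \<subseteq> N \<and> |X| <o \<kappa>}. H X| <o \<mu>"
      by (rule regularCard_UNION_bound) (use \<mu> N sharp H in \<open>auto simp: regular_cardinal_def sharply_below_def\<close>)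
    then show ?thesis
      unfolding step_def using N \<open>Card_order \<mu>\<close> \<open>infinite (Field \<mu>)\<close>
      by (intro card_of_Un_ordLess_infinite_Field) auto
  qed
  have stage_small: "|stage a| <o \<mu>" for a
  proof (induction a rule: wf_induct_rule[OF wf])
    case (1 a)
    have "underS \<kappa> a \<subseteq> Field \<kappa>" by (auto simp: underS_def Field_def)
    then have "|underS \<kappa> a| <o \<mu>"
      using card_of_mono1 Field_small ordLeq_ordLess_trans by blast
    then have "|\<Union>b \<in> underS \<kappa> a. step (stage b)| <o \<mu>"
      using 1 \<mu> by (intro regularCard_UNION_bound step_small) (auto simp: regular_cardinal_def underS_def)
    then show ?case
      using M0 \<open>Card_order \<mu>\<close> \<open>infinite (Field \<mu>)\<close> by (subst stage) (intro card_of_Un_ordLess_infinite_Field, auto)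
  qed
  have M_small: "|M| <o \<mu>"
    unfolding M_def using \<mu> stage_small Field_small
    by (intro regularCard_UNION_bound) (auto simp: regular_cardinal_def)
  have step_sub: "step (stage a) \<subseteq> M" if a: "a \<in> Field \<kappa>" for a
  proof -
    obtain b where "b \<in> Field \<kappa>" "a \<noteq> b" "(a, b) \<in> \<kappa>"
      using infinite_Card_order_limit[OF \<open>Card_order \<kappa>\<close> \<open>infinite (Field \<kappa>)\<close> a] by auto
    then have "step (stage a) \<subseteq> stage b" by (subst (2) stage) (auto simp: underS_def)
    then show ?thesis using \<open>b \<in> Field \<kappa>\<close> by (auto simp: M_def)
  qed
  have chain: "relChain \<kappa> stage"
  proof -
    have "stage a \<subseteq> stage b" if "(a, b) \<in> \<kappa>" for a b
    proof (cases "a = b")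
      case False
      then have "step (stage a) \<subseteq> stage b" using that by (subst (2) stage) (auto simp: underS_def)
      then show ?thesis by (auto simp: step_def)
    qed simp
    then show ?thesis by (simp add: relChain_def)
  qed
  have "H X \<subseteq> M" if X: "X \<subseteq> M" "|X| <o \<kappa>" for X
  proof -
    obtain a where a: "a \<in> Field \<kappa>" "X \<subseteq> stage a"
      using regularCard_UNION[OF \<open>Card_order \<kappa>\<close> \<open>regularCard \<kappa>\<close> chain X(1)[unfolded M_def] X(2)] by blast
    then have "H X \<subseteq> step (stage a)" using X(2) by (auto simp: step_def)
    then show ?thesis using step_sub[OF a(1)] by auto
  qed
  moreover have "M0 \<subseteq> M"
  proof -
    obtain a where "a \<in> Field \<kappa>" using \<open>infinite (Field \<kappa>)\<close> by (metis ex_in_conv finite.emptyI)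
    then show ?thesis unfolding M_def using stage[of a] by blast
  qed
  ultimately show ?thesis using M_small by blast
qed

lemma card_of_Pow_mono:
  assumes "|A| \<le>o |B|"
  shows "|Pow A| \<le>o |Pow B|"
proof -
  obtain f where f: "inj_on f A" "f ` A \<subseteq> B" using assms card_of_ordLeq by metis
  then have "inj_on ((`) f) (Pow A)" "(`) f ` Pow A \<subseteq> Pow B" by (auto simp: inj_on_image_Pow)
  then show ?thesis using card_of_ordLeq by metis
qed

text \<open>
  The successor of \<open>2\<^sup>s\<close> for \<open>s = \<kappa> + \<kappa>'\<close> works, since \<open>(2\<^sup>s)\<^sup>s = 2\<^sup>s\<close>. It is again a set because the size of
  the universe is a strong limit.
\<close>

lemma exists_sharply_above:
  fixes \<kappa> \<kappa>' :: "'u rel"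
  assumes universe: "inaccessible |UNIV :: 'u set|"
    and \<kappa>: "regular_cardinal \<kappa>" and \<kappa>': "regular_cardinal \<kappa>'"
  shows "\<exists>\<mu> :: 'u rel. regular_cardinal \<mu> \<and> sharply_below \<kappa> \<mu> \<and> \<kappa>' <o \<mu>"
proof -
  note regular_cardinalD[OF \<kappa>] and regular_cardinalD[OF \<kappa>']
  have strong_limit: "|Pow X| <o |UNIV :: 'u set|" if "|X| <o |UNIV :: 'u set|" for X :: "'u set"
    using universe that by (simp add: inaccessible_def)
  have inf: "infinite (UNIV :: 'u set)"
    using \<open>Cinfinite \<kappa>\<close> by (rule infinite_UNIV_if_Cinfinite)
  define S where "S = Field \<kappa> \<union> Field \<kappa>'"
  have infS: "infinite S" using \<open>infinite (Field \<kappa>)\<close> by (simp add: S_def)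
  have S_small: "|S| <o |UNIV :: 'u set|"
    unfolding S_def using inf \<open>|Field \<kappa>| <o |UNIV|\<close> \<open>|Field \<kappa>'| <o |UNIV|\<close>
    by (intro card_of_Un_ordLess_infinite)
  have \<kappa>S: "\<kappa> \<le>o |S|" "\<kappa>' \<le>o |S|"
    using ordIso_ordLeq_trans[OF ordIso_symmetric[OF \<open>|Field \<kappa>| =o \<kappa>\<close>], of "|S|"]
      ordIso_ordLeq_trans[OF ordIso_symmetric[OF \<open>|Field \<kappa>'| =o \<kappa>'\<close>], of "|S|"]
    by (simp_all add: S_def card_of_mono1)
  let ?P = "Pow S"
  have PP_small: "|Pow ?P| <o |UNIV :: 'u set|"
  proof -
    obtain j :: "'u set \<Rightarrow> 'u" where j: "inj_on j ?P"
      using strong_limit[OF S_small] card_of_ordLeq[of ?P "UNIV :: 'u set"] ordLess_imp_ordLeq by blast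
    then have iso: "|?P| =o |j ` ?P|"
      using card_of_ordIso bij_betw_imageI by blast
    then have "|j ` ?P| <o |UNIV :: 'u set|"
      using strong_limit[OF S_small] ordIso_ordLess_trans ordIso_symmetric by blast
    then have "|Pow (j ` ?P)| <o |UNIV :: 'u set|" by (rule strong_limit)
    moreover have "|Pow ?P| \<le>o |Pow (j ` ?P)|"
      using iso by (intro card_of_Pow_mono) (simp add: ordIso_iff_ordLeq)
    ultimately show ?thesis using ordLeq_ordLess_trans by blast
  qed
  have infP: "Cinfinite |?P|" using infS card_of_Card_order[of "Pow S"] by (simp add: cinfinite_def Field_card_of)
  have "cardSuc |?P| \<le>o |Pow ?P|"
    by (rule cardSuc_least[OF card_of_Card_order card_of_Card_order card_of_Pow])
  then have "cardSuc |?P| <o |UNIV :: 'u set|" using PP_small ordLeq_ordLess_trans by blast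
  then obtain \<mu> :: "'u rel" where \<mu>: "cardSuc |?P| =o \<mu>" "\<mu> <o |UNIV :: 'u set|"
    by (auto simp: internalize_ordLess[of "cardSuc |?P|"])
  have reg: "regular_cardinal \<mu>"
    unfolding regular_cardinal_def
    using \<mu> infP by (meson Cinfinite_cardSuc Cinfinite_cong regularCard_cardSuc regularCard_ordIso)
  note regular_cardinalD[OF this]
  have P_less: "|?P| <o \<mu>"
    using cardSuc_greater[OF card_of_Card_order] \<mu>(1) ordLess_ordIso_trans by blast
  have "|S| <o \<mu>" using card_of_Pow P_less ordLess_transitive by blast
  then have less: "\<kappa> <o \<mu>" "\<kappa>' <o \<mu>" using \<kappa>S ordLeq_ordLess_trans by blast+
  have "|{X. X \<subseteq> M \<and> |X| <o \<kappa>}| <o \<mu>" if M: "|M| <o \<mu>" for M :: "'u set"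
  proof -
    have "|M| <o cardSuc |?P|" using M \<mu>(1) ordIso_symmetric ordLess_ordIso_trans by blast
    then have "|M| \<le>o |?P|" by (simp add: cardSuc_ordLeq_ordLess card_of_Card_order)
    then obtain j where j: "inj_on j M" "j ` M \<subseteq> ?P"
      using card_of_ordLeq[of M ?P] by auto
    \<comment> \<open>With \<open>j\<close> embedding \<open>M\<close> into the subsets of \<open>S\<close>, a relation \<open>R\<close> on \<open>S\<close> codes the set of those elements of \<open>M\<close> whose image under \<open>j\<close> is a row of \<open>R\<close>.\<close>
    define dec where "dec R = {m \<in> M. \<exists>s \<in> S. j m = {t \<in> S. (s, t) \<in> R}}" for R
    have "{X. X \<subseteq> M \<and> |X| <o \<kappa>} \<subseteq> insert {} (dec ` Pow (S \<times> S))"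
    proof clarify
      fix X assume X: "X \<subseteq> M" "|X| <o \<kappa>" "X \<notin> dec ` Pow (S \<times> S)"
      show "X = {}"
      proof (rule ccontr)
        assume "X \<noteq> {}"
        moreover have "|X| \<le>o |S|"
          using X(2) \<kappa>S(1) ordLess_ordLeq_trans ordLess_imp_ordLeq by blast
        ultimately obtain g where g: "g ` S = X" using card_of_ordLeq2 by metis
        define R where "R = {(s, t). s \<in> S \<and> t \<in> j (g s)}"
        have row: "{t \<in> S. (s, t) \<in> R} = j (g s)" if "s \<in> S" for s
          using that g X(1) j(2) by (auto simp: R_def)
        have "dec R = X"
          using g X(1) j(1) by (auto simp: dec_def row inj_on_def)
        moreover have "R \<in> Pow (S \<times> S)" using g X(1) j(2) by (auto simp: R_def)
        ultimately show False using X(3) by blast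
      qed
    qed
    then have "|{X. X \<subseteq> M \<and> |X| <o \<kappa>}| \<le>o |{{}} \<union> dec ` Pow (S \<times> S)|"
      by (intro card_of_mono1) auto
    moreover have "|{{}} \<union> dec ` Pow (S \<times> S)| <o \<mu>"
    proof (rule card_of_Un_ordLess_infinite_Field)
      show "|{{} :: 'u set}| <o \<mu>"
        by (rule finite_less_Cinfinite[OF \<open>Cinfinite \<mu>\<close>]) simp
      have "|dec ` Pow (S \<times> S)| \<le>o |Pow (S \<times> S)|" by (rule card_of_image)
      also have "|Pow (S \<times> S)| \<le>o |Pow S|"
        using card_of_Times_same_infinite[OF infS] by (intro card_of_Pow_mono) (simp add: ordIso_iff_ordLeq)
      finally show "|dec ` Pow (S \<times> S)| <o \<mu>" using P_less ordLeq_ordLess_trans by blast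
    qed (use \<open>Card_order \<mu>\<close> \<open>infinite (Field \<mu>)\<close> in auto)
    ultimately show ?thesis using ordLeq_ordLess_trans by blast
  qed
  then show ?thesis using reg less by (auto simp: sharply_below_def)
qed

section \<open>Categories, functors and colimits\<close>

lemma homD:
  assumes "f \<in> hom C A B"
  shows "f \<in> Mor C" "Dom C f = A" "Cod C f = B"
  using assms by (auto simp: hom_def)

lemma hom_obj:
  assumes "category C" "f \<in> hom C A B"
  shows "A \<in> Obj C" "B \<in> Obj C"
  using assms by (auto simp: hom_def category_def)

lemma Mor_hom: "f \<in> Mor C \<Longrightarrow> f \<in> hom C (Dom C f) (Cod C f)"
  by (simp add: hom_def)

lemma Id_hom: "category C \<Longrightarrow> A \<in> Obj C \<Longrightarrow> Id C A \<in> hom C A A"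
  by (simp add: category_def)

lemma Comp_hom:
  "category C \<Longrightarrow> f \<in> hom C A B \<Longrightarrow> g \<in> hom C B E \<Longrightarrow> Comp C g f \<in> hom C A E"
  by (auto simp: hom_def category_def)

lemma Comp_assoc:
  "category C \<Longrightarrow> f \<in> hom C A B \<Longrightarrow> g \<in> hom C B E \<Longrightarrow> h \<in> hom C E H \<Longrightarrow>
   Comp C h (Comp C g f) = Comp C (Comp C h g) f"
  by (auto simp: hom_def category_def)

lemma Comp_Id: "category C \<Longrightarrow> f \<in> hom C A B \<Longrightarrow> Comp C f (Id C A) = f"
  by (auto simp: hom_def category_def)

lemma Id_Comp: "category C \<Longrightarrow> f \<in> hom C A B \<Longrightarrow> Comp C (Id C B) f = f"
  by (auto simp: hom_def category_def)

lemma functor_hom: "is_functor C D F \<Longrightarrow> f \<in> hom C A B \<Longrightarrow> on_mor F f \<in> hom D (on_obj F A) (on_obj F B)"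
  by (auto simp: hom_def is_functor_def)

lemma functor_Comp:
  "is_functor C D F \<Longrightarrow> f \<in> hom C A B \<Longrightarrow> g \<in> hom C B E \<Longrightarrow>
   on_mor F (Comp C g f) = Comp D (on_mor F g) (on_mor F f)"
  by (auto simp: hom_def is_functor_def)

lemma is_functor_comp: "is_functor C D F \<Longrightarrow> is_functor D E G \<Longrightarrow> is_functor C E (comp_func G F)"
  unfolding is_functor_def comp_func_def hom_def by simp

lemma comp_func_sel [simp]:
  "on_obj (comp_func G F) A = on_obj G (on_obj F A)" "on_mor (comp_func G F) f = on_mor G (on_mor F f)"
  by (simp_all add: comp_func_def)

lemma cocone_hom: "is_cocone I C D A c \<Longrightarrow> i \<in> Obj I \<Longrightarrow> c i \<in> hom C (on_obj D i) A"
  by (simp add: is_cocone_def)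

lemma cocone_obj: "is_cocone I C D A c \<Longrightarrow> A \<in> Obj C"
  by (simp add: is_cocone_def)

lemma cocone_commute: "is_cocone I C D A c \<Longrightarrow> u \<in> hom I i j \<Longrightarrow> Comp C (c j) (on_mor D u) = c i"
  by (auto simp: is_cocone_def hom_def)

lemma colimit_cocone: "is_colimit I C D A c \<Longrightarrow> is_cocone I C D A c"
  by (simp add: is_colimit_def)

lemma colimit_factor:
  "is_colimit I C D A c \<Longrightarrow> is_cocone I C D B d \<Longrightarrow>
   \<exists>u \<in> hom C A B. \<forall>i \<in> Obj I. Comp C u (c i) = d i"
  unfolding is_colimit_def Bex_def by (blast dest: ex1_implies_ex)

lemma cocone_push:
  assumes "category C" "is_functor I C D" "is_cocone I C D A c" "u \<in> hom C A B"
  shows "is_cocone I C D B (\<lambda>i. Comp C u (c i))"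
  unfolding is_cocone_def
proof (intro conjI ballI)
  fix f assume f: "f \<in> Mor I"
  then have "on_mor D f \<in> hom C (on_obj D (Dom I f)) (on_obj D (Cod I f))" "Cod I f \<in> Obj I"
    using assms(2) by (auto simp: is_functor_def category_def)
  then show "Comp C (Comp C u (c (Cod I f))) (on_mor D f) = Comp C u (c (Dom I f))"
    using assms(1,3,4) cocone_commute[OF assms(3) Mor_hom[OF f]] Comp_assoc[OF assms(1), of "on_mor D f"]
    by (metis cocone_hom)
next
  show "B \<in> Obj C" using hom_obj[OF assms(1,4)] by simp
next
  fix i assume "i \<in> Obj I"
  then show "Comp C u (c i) \<in> hom C (on_obj D i) B"
    using Comp_hom[OF assms(1) cocone_hom[OF assms(3)] assms(4)] by simp
qed

text \<open>
  The uniqueness half of the universal property, in the form in which equalities of morphisms out of a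
  colimit are checked below.
\<close>

lemma colimit_jointly_epi:
  assumes "category C" "is_functor I C D" "is_colimit I C D A c"
    and u: "u \<in> hom C A B" "v \<in> hom C A B" and eq: "\<And>i. i \<in> Obj I \<Longrightarrow> Comp C u (c i) = Comp C v (c i)"
  shows "u = v"
proof -
  have "is_cocone I C D B (\<lambda>i. Comp C v (c i))"
    using cocone_push[OF assms(1,2) colimit_cocone[OF assms(3)]] u by blast
  then have "\<exists>!w. w \<in> hom C A B \<and> (\<forall>i \<in> Obj I. Comp C w (c i) = Comp C v (c i))"
    using assms(3) by (auto simp: is_colimit_def)
  then show ?thesis using u eq by (metis (no_types, lifting))
qed

lemma colimitI:
  assumes "is_cocone I C D A c"
    and "\<And>B d. is_cocone I C D B d \<Longrightarrow> \<exists>u \<in> hom C A B. \<forall>i \<in> Obj I. Comp C u (c i) = d i"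
    and "\<And>B u v. u \<in> hom C A B \<Longrightarrow> v \<in> hom C A B \<Longrightarrow>
      (\<And>i. i \<in> Obj I \<Longrightarrow> Comp C u (c i) = Comp C v (c i)) \<Longrightarrow> u = v"
  shows "is_colimit I C D A c"
  unfolding is_colimit_def
proof (intro conjI allI impI)
  fix B d assume "is_cocone I C D B d"
  then obtain u where u: "u \<in> hom C A B" "\<forall>i \<in> Obj I. Comp C u (c i) = d i" using assms(2) by blast
  show "\<exists>!u. u \<in> hom C A B \<and> (\<forall>i \<in> Obj I. Comp C u (c i) = d i)"
  proof (rule ex1I[of _ u])
    fix v assume v: "v \<in> hom C A B \<and> (\<forall>i \<in> Obj I. Comp C v (c i) = d i)"
    show "v = u" by (rule assms(3)) (use u v in auto)
  qed (use u in simp)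
qed (rule assms(1))

section \<open>Filtered categories\<close>

text \<open>
  A cocone on a set of arrows rather than on a functor. Filteredness becomes a property of subsets of
  \<open>Mor I\<close>, which is what a closure argument on arrows can handle.
\<close>

definition arrow_cocone :: "('o, 'm) cat \<Rightarrow> 'm set \<Rightarrow> 'o \<Rightarrow> ('o \<Rightarrow> 'm) \<Rightarrow> bool" where
  "arrow_cocone I X A c \<longleftrightarrow> A \<in> Obj I \<and>
     (\<forall>f \<in> X. c (Dom I f) \<in> hom I (Dom I f) A \<and> c (Cod I f) \<in> hom I (Cod I f) A \<and>
       Comp I (c (Cod I f)) f = c (Dom I f))"

text \<open>
  The arrows in \<open>X\<close> need not be the image of a functor from a category with fewer than \<open>\<kappa>\<close> morphisms: for
  \<open>\<kappa> = \<omega>\<close>, the subcategory that they generate can be infinite. Instead, \<open>X\<close> is subdivided. The shape \<open>J\<close>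
  has an object for each end \<open>i\<close> of an arrow and one for each \<open>f \<in> X\<close>, and the latter has arrows to the
  domain and to the codomain of \<open>f\<close>, which go to the identity and to \<open>f\<close>. No two of these arrows
  compose, so \<open>J\<close> is about as large as \<open>X\<close>.
\<close>

lemma arrow_cocone_if_filtered:
  fixes I :: "('u, 'u) cat"
  assumes \<kappa>: "Cinfinite \<kappa>" and I: "filtered \<kappa> I" and X: "X \<subseteq> Mor I" "|X| <o \<kappa>"
  shows "\<exists>A c. arrow_cocone I X A c"
proof -
  have cat: "category I" using I by (simp add: filtered_def)
  have "infinite (UNIV :: 'u set)"
    using \<kappa> by (rule infinite_UNIV_if_Cinfinite)
  then obtain e :: "nat \<times> 'u \<Rightarrow> 'u" where e: "inj e" using exists_tagging by blast
  then have e_eq [simp]: "e p = e q \<longleftrightarrow> p = q" for p q by (simp add: inj_eq)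
  have inv [simp]: "inv e (e p) = p" for p using e by simp
  \<comment> \<open>The tags 0 and 1 mark the two kinds of objects, each serving as its own identity; 2 and 3 mark the arrows to the domain and to the codomain.\<close>
  define V where "V = Dom I ` X \<union> Cod I ` X"
  have V: "V \<subseteq> Obj I" using X(1) cat by (auto simp: V_def category_def)
  define Ob where "Ob = (\<lambda>i. e (0, i)) ` V \<union> (\<lambda>f. e (1, f)) ` X"
  define J :: "('u, 'u) cat" where "J = \<lparr>Obj = Ob,
      Mor = Ob \<union> (\<lambda>f. e (2, f)) ` X \<union> (\<lambda>f. e (3, f)) ` X,
      Dom = (\<lambda>m. case inv e m of (k, x) \<Rightarrow> if k < 2 then m else e (1, x)),
      Cod = (\<lambda>m. case inv e m of (k, x) \<Rightarrow> if k < 2 then m else if k = 2 then e (0, Dom I x) else e (0, Cod I x)),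
      Id = (\<lambda>m. m),
      Comp = (\<lambda>g f. case inv e f of (k, x) \<Rightarrow> if k < 2 then g else f)\<rparr>"
  have J_sel: "Obj J = Ob" "Mor J = Ob \<union> (\<lambda>f. e (2, f)) ` X \<union> (\<lambda>f. e (3, f)) ` X" "Id J m = m"
    "Dom J (e (k, x)) = (if k < 2 then e (k, x) else e (1, x))"
    "Cod J (e (k, x)) = (if k < 2 then e (k, x) else if k = 2 then e (0, Dom I x) else e (0, Cod I x))"
    "Comp J g (e (k, x)) = (if k < 2 then g else e (k, x))" for k x g m
    by (simp_all add: J_def)
  have Mor_cases: "(\<exists>i \<in> V. m = e (0, i)) \<or> (\<exists>f \<in> X. m = e (1, f)) \<or> (\<exists>f \<in> X. m = e (2, f)) \<or> (\<exists>f \<in> X. m = e (3, f))"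
    if "m \<in> Mor J" for m using that by (auto simp: J_sel Ob_def)
  define D :: "('u, 'u, 'u, 'u) func" where "D = \<lparr>
      on_obj = (\<lambda>m. case inv e m of (k, x) \<Rightarrow> if k = 0 then x else Dom I x),
      on_mor = (\<lambda>m. case inv e m of (k, x) \<Rightarrow> if k = 0 then Id I x else if k < 3 then Id I (Dom I x) else x)\<rparr>"
  have D_sel: "on_obj D (e (k, x)) = (if k = 0 then x else Dom I x)"
    "on_mor D (e (k, x)) = (if k = 0 then Id I x else if k < 3 then Id I (Dom I x) else x)" for k x
    by (simp_all add: D_def)
  have VX: "Dom I f \<in> V" "Cod I f \<in> V" "f \<in> Mor I" if "f \<in> X" for f using that X(1) by (auto simp: V_def)
  have "category J"
    unfolding category_def
  proof (intro conjI ballI impI)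
    fix f g assume fg: "f \<in> Mor J" "g \<in> Mor J" "Cod J f = Dom J g"
    show "Comp J g f \<in> hom J (Dom J f) (Cod J g)"
      using Mor_cases[OF fg(1)] Mor_cases[OF fg(2)] fg by (auto simp: J_sel hom_def)
    fix h assume h: "h \<in> Mor J" "Cod J g = Dom J h"
    show "Comp J h (Comp J g f) = Comp J (Comp J h g) f"
      using Mor_cases[OF fg(1)] Mor_cases[OF fg(2)] fg by (auto simp: J_sel)
  next
    fix f assume f: "f \<in> Mor J"
    show "Dom J f \<in> Obj J" "Cod J f \<in> Obj J"
      using Mor_cases[OF f] VX by (auto simp: J_sel Ob_def)
    show "Comp J f (Id J (Dom J f)) = f" "Comp J (Id J (Cod J f)) f = f"
      using Mor_cases[OF f] by (auto simp: J_sel)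
  next
    fix A assume "A \<in> Obj J"
    then show "Id J A \<in> hom J A A" by (auto simp: J_sel Ob_def hom_def)
  qed
  have Id_I: "Comp I f (Id I (Dom I f)) = f" "Comp I (Id I (Cod I f)) f = f" if "f \<in> X" for f
    using VX(3)[OF that] cat by (auto simp: category_def)
  have Id_Id: "Comp I (Id I i) (Id I i) = Id I i" if "i \<in> V" for i
    using that V cat by (metis Comp_Id Id_hom subsetD)
  have IdV: "Id I i \<in> Mor I" "Dom I (Id I i) = i" "Cod I (Id I i) = i" if "i \<in> V" for i
    using homD[OF Id_hom[OF cat]] that V by blast+
  have "is_functor J I D"
    unfolding is_functor_def
  proof (intro conjI ballI impI)
    fix f assume f: "f \<in> Mor J"
    show "on_mor D f \<in> hom I (on_obj D (Dom J f)) (on_obj D (Cod J f))"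
      using Mor_cases[OF f] VX IdV by (auto simp: J_sel D_sel hom_def)
    fix g assume fg: "g \<in> Mor J" "Cod J f = Dom J g"
    show "on_mor D (Comp J g f) = Comp I (on_mor D g) (on_mor D f)"
      using Mor_cases[OF f] Mor_cases[OF fg(1)] fg VX IdV Id_Id Id_I by (auto simp: J_sel D_sel)
  next
    fix A assume "A \<in> Obj J"
    then show "on_obj D A \<in> Obj I" "on_mor D (Id J A) = Id I (on_obj D A)"
      using VX V by (auto simp: J_sel D_sel Ob_def)
  qed (use cat \<open>category J\<close> in auto)
  moreover have "|Mor J| <o \<kappa>"
  proof -
    have im: "|h ` X| <o \<kappa>" for h :: "'u \<Rightarrow> 'u"
      using card_of_image X(2) ordLeq_ordLess_trans by blast
    have "Mor J = (\<lambda>f. e (0, Dom I f)) ` X \<union> (\<lambda>f. e (0, Cod I f)) ` X \<union> (\<lambda>f. e (1, f)) ` X \<union>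
        (\<lambda>f. e (2, f)) ` X \<union> (\<lambda>f. e (3, f)) ` X"
      by (auto simp: J_sel Ob_def V_def)
    then show ?thesis
      using \<kappa> im by (auto simp: cinfinite_def intro!: card_of_Un_ordLess_infinite_Field)
  qed
  ultimately obtain A c where c: "is_cocone J I D A c"
    using I unfolding filtered_def by blast
  have "arrow_cocone I X A (\<lambda>i. c (e (0, i)))"
    unfolding arrow_cocone_def
  proof (intro conjI ballI)
    fix f assume f: "f \<in> X"
    have obj: "c (e (0, i)) \<in> hom I i A" if "i \<in> V" for i
      using cocone_hom[OF c, of "e (0, i)"] that by (auto simp: J_sel D_sel Ob_def)
    then show "c (e (0, Dom I f)) \<in> hom I (Dom I f) A" "c (e (0, Cod I f)) \<in> hom I (Cod I f) A"
      using VX[OF f] by auto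
    have "e (2, f) \<in> hom J (e (1, f)) (e (0, Dom I f))" "e (3, f) \<in> hom J (e (1, f)) (e (0, Cod I f))"
      using f by (auto simp: J_sel hom_def)
    from this[THEN cocone_commute[OF c]]
    have "Comp I (c (e (0, Dom I f))) (Id I (Dom I f)) = c (e (1, f))"
      "Comp I (c (e (0, Cod I f))) f = c (e (1, f))"
      by (auto simp: D_sel)
    moreover have "Comp I (c (e (0, Dom I f))) (Id I (Dom I f)) = c (e (0, Dom I f))"
      using Comp_Id[OF cat obj] VX[OF f] by blast
    ultimately show "Comp I (c (e (0, Cod I f))) f = c (e (0, Dom I f))" by simp
  qed (use cocone_obj[OF c] in simp)
  then show ?thesis by blast
qed

lemma filtered_if_arrow_cocones:
  assumes "category I" and cocones: "\<And>X. X \<subseteq> Mor I \<Longrightarrow> |X| <o \<kappa> \<Longrightarrow> \<exists>A c. arrow_cocone I X A c"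
  shows "filtered \<kappa> I"
  unfolding filtered_def
proof (intro conjI allI impI)
  fix J :: "('u, 'u) cat" and D
  assume J: "is_functor J I D \<and> |Mor J| <o \<kappa>"
  have D: "on_mor D f \<in> Mor I" "Dom I (on_mor D f) = on_obj D (Dom J f)" "Cod I (on_mor D f) = on_obj D (Cod J f)"
    if "f \<in> Mor J" for f using J that by (auto simp: is_functor_def hom_def)
  have "|on_mor D ` Mor J| <o \<kappa>" using J card_of_image ordLeq_ordLess_trans by blast
  moreover have "on_mor D ` Mor J \<subseteq> Mor I" using D by auto
  ultimately obtain A c where c: "arrow_cocone I (on_mor D ` Mor J) A c" using cocones by blast
  have "is_cocone J I D A (\<lambda>i. c (on_obj D i))"
    unfolding is_cocone_def
  proof (intro conjI ballI)
    fix i assume i: "i \<in> Obj J"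
    then have "Id J i \<in> Mor J" "Dom J (Id J i) = i"
      using J Id_hom[of J i] by (auto simp: is_functor_def hom_def)
    then show "c (on_obj D i) \<in> hom I (on_obj D i) A"
      using c D(2)[of "Id J i"] unfolding arrow_cocone_def by (metis imageI)
  next
    fix f assume "f \<in> Mor J"
    then show "Comp I (c (on_obj D (Cod J f))) (on_mor D f) = c (on_obj D (Dom J f))"
      using c D[of f] by (auto simp: arrow_cocone_def)
  qed (use c in \<open>simp add: arrow_cocone_def\<close>)
  then show "\<exists>A c. is_cocone J I D A c" by blast
qed (rule assms(1))

lemma filtered_antimono: "\<kappa> \<le>o \<mu> \<Longrightarrow> filtered \<mu> I \<Longrightarrow> filtered \<kappa> I"
  unfolding filtered_def using ordLess_ordLeq_trans by blast

lemma filtered_diagram_antimono: "\<kappa> \<le>o \<mu> \<Longrightarrow> filtered_diagram \<mu> I C D \<Longrightarrow> filtered_diagram \<kappa> I C D"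
  unfolding filtered_diagram_def using filtered_antimono by blast

lemma filtered_upper_bound:
  assumes \<kappa>: "Cinfinite \<kappa>" "filtered \<kappa> I" and X: "X \<subseteq> Obj I" "|X| <o \<kappa>"
  shows "\<exists>k c. k \<in> Obj I \<and> (\<forall>i \<in> X. c i \<in> hom I i k)"
proof -
  have cat: "category I" using \<kappa> by (simp add: filtered_def)
  have "|Id I ` X| <o \<kappa>" using X(2) card_of_image ordLeq_ordLess_trans by blast
  moreover have "Id I ` X \<subseteq> Mor I" using X(1) homD(1)[OF Id_hom[OF cat]] by (meson image_subsetI subsetD)
  ultimately obtain k c where "arrow_cocone I (Id I ` X) k c"
    using arrow_cocone_if_filtered[OF \<kappa>] by blast
  moreover have "Dom I (Id I i) = i" if "i \<in> X" for i using homD(2)[OF Id_hom[OF cat subsetD[OF X(1) that]]] .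
  ultimately have "k \<in> Obj I \<and> (\<forall>i \<in> X. c i \<in> hom I i k)" unfolding arrow_cocone_def by (metis imageI)
  then show ?thesis by blast
qed

lemma filtered_join:
  assumes \<kappa>: "Cinfinite \<kappa>" "filtered \<kappa> I" and "i \<in> Obj I" "j \<in> Obj I"
  shows "\<exists>k u v. u \<in> hom I i k \<and> v \<in> hom I j k"
  using filtered_upper_bound[OF \<kappa>, of "{i, j}"] finite_less_Cinfinite[OF \<kappa>(1), of "{i, j}"] assms(3,4)
  by auto

lemma filtered_square:
  assumes \<kappa>: "Cinfinite \<kappa>" "filtered \<kappa> I" and u: "u \<in> hom I i j" and v: "v \<in> hom I i k"
  shows "\<exists>l p q. p \<in> hom I j l \<and> q \<in> hom I k l \<and> Comp I p u = Comp I q v"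
proof -
  have "{u, v} \<subseteq> Mor I" using u v by (auto simp: hom_def)
  then obtain l c where "arrow_cocone I {u, v} l c"
    using arrow_cocone_if_filtered[OF \<kappa>, of "{u, v}"] finite_less_Cinfinite[OF \<kappa>(1), of "{u, v}"] by auto
  then have "c j \<in> hom I j l \<and> c k \<in> hom I k l \<and> Comp I (c j) u = Comp I (c k) v"
    using homD[OF u] homD[OF v] by (auto simp: arrow_cocone_def)
  then show ?thesis by blast
qed

lemma filtered_coequalise:
  assumes \<kappa>: "Cinfinite \<kappa>" "filtered \<kappa> I" and u: "u \<in> hom I i j" and v: "v \<in> hom I i j"
  shows "\<exists>l w. w \<in> hom I j l \<and> Comp I w u = Comp I w v"
proof -
  have "{u, v} \<subseteq> Mor I" using u v by (auto simp: hom_def)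
  then obtain l c where "arrow_cocone I {u, v} l c"
    using arrow_cocone_if_filtered[OF \<kappa>, of "{u, v}"] finite_less_Cinfinite[OF \<kappa>(1), of "{u, v}"] by auto
  then have "c j \<in> hom I j l \<and> Comp I (c j) u = Comp I (c j) v"
    using homD[OF u] homD[OF v] by (auto simp: arrow_cocone_def)
  then show ?thesis by blast
qed

section \<open>Presentability by stages\<close>

lemma Set_cat_hom:
  "u \<in> hom Set_cat X Y \<longleftrightarrow> (\<exists>t. u = (X, t, Y) \<and> small X \<and> small Y \<and> t \<in> X \<rightarrow>\<^sub>E Y)"
  by (cases u) (auto simp: hom_def Set_cat_def)

lemma Set_cat_Comp: "Comp Set_cat (Y', g, Z) (X, f, Y) = (X, compose X g f, Z)"
  by (simp add: Set_cat_def)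

lemma hom_func_sel:
  "on_obj (hom_func C A) B = hom C A B"
  "f \<in> hom C B E \<Longrightarrow> on_mor (hom_func C A) f = (hom C A B, restrict (Comp C f) (hom C A B), hom C A E)"
  by (auto simp: hom_func_def hom_def)

lemma class_categoryD:
  "class_category C \<Longrightarrow> category C"
  "class_category C \<Longrightarrow> A \<in> Obj C \<Longrightarrow> B \<in> Obj C \<Longrightarrow> small (hom C A B)"
  by (auto simp: class_category_def)

text \<open>
  A cocone on \<open>hom(A, D -)\<close> in the category of sets, stripped of its bookkeeping of domains and
  codomains.
\<close>

definition hom_compatible ::
  "('u, 'u) cat \<Rightarrow> 'u \<Rightarrow> ('u, 'u) cat \<Rightarrow> ('u, 'u, 'u, 'u) func \<Rightarrow> 'u set \<Rightarrow> ('u \<Rightarrow> 'u \<Rightarrow> 'u) \<Rightarrow> bool" where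
  "hom_compatible C A I D B \<delta> \<longleftrightarrow>
     (\<forall>i \<in> Obj I. \<forall>g \<in> hom C A (on_obj D i). \<delta> i g \<in> B) \<and>
     (\<forall>u \<in> Mor I. \<forall>g \<in> hom C A (on_obj D (Dom I u)). \<delta> (Cod I u) (Comp C (on_mor D u) g) = \<delta> (Dom I u) g)"

lemma hom_set_cocone_iff:
  assumes C: "class_category C" and A: "A \<in> Obj C" and D: "is_functor I C D" and B: "small B"
    and t: "\<And>i. i \<in> Obj I \<Longrightarrow> t i \<in> hom C A (on_obj D i) \<rightarrow>\<^sub>E B"
  shows "is_cocone I Set_cat (comp_func (hom_func C A) D) B (\<lambda>i. (hom C A (on_obj D i), t i, B)) \<longleftrightarrow>
    hom_compatible C A I D B t"
proof -
  have small_hom: "small (hom C A (on_obj D i))" if "i \<in> Obj I" for i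
    using class_categoryD(2)[OF C A] D that by (simp add: is_functor_def)
  have I: "Dom I u \<in> Obj I" "Cod I u \<in> Obj I" if "u \<in> Mor I" for u
    using D that by (auto simp: is_functor_def category_def)
  have Du: "on_mor D u \<in> hom C (on_obj D (Dom I u)) (on_obj D (Cod I u))" if "u \<in> Mor I" for u
    using D that by (simp add: is_functor_def)
  have square: "Comp Set_cat (hom C A (on_obj D (Cod I u)), t (Cod I u), B) (on_mor (hom_func C A) (on_mor D u)) =
        (hom C A (on_obj D (Dom I u)), t (Dom I u), B) \<longleftrightarrow>
      (\<forall>g \<in> hom C A (on_obj D (Dom I u)). t (Cod I u) (Comp C (on_mor D u) g) = t (Dom I u) g)"
    (is "?l \<longleftrightarrow> ?r") if u: "u \<in> Mor I" for u
  proof -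
    let ?X = "hom C A (on_obj D (Dom I u))"
    have "?l \<longleftrightarrow> compose ?X (t (Cod I u)) (restrict (Comp C (on_mor D u)) ?X) = t (Dom I u)"
      by (simp add: hom_func_sel(2)[OF Du[OF u]] Set_cat_Comp)
    also have "\<dots> \<longleftrightarrow> ?r"
    proof
      assume r: ?r
      show "compose ?X (t (Cod I u)) (restrict (Comp C (on_mor D u)) ?X) = t (Dom I u)"
        by (rule extensionalityI[of _ ?X])
          (use r t[OF I(1)[OF u]] in \<open>auto simp: compose_def PiE_def\<close>)
    next
      assume l: "compose ?X (t (Cod I u)) (restrict (Comp C (on_mor D u)) ?X) = t (Dom I u)"
      show ?r
      proof
        fix g assume "g \<in> ?X"
        then show "t (Cod I u) (Comp C (on_mor D u) g) = t (Dom I u) g"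
          using fun_cong[OF l, of g] by (simp add: compose_def)
      qed
    qed
    finally show ?thesis .
  qed
  have B_obj: "B \<in> Obj Set_cat" using B by (simp add: Set_cat_def)
  have t_hom: "(hom C A (on_obj D i), t i, B) \<in> hom Set_cat (hom C A (on_obj D i)) B" if "i \<in> Obj I" for i
    using t[OF that] small_hom[OF that] B by (auto simp: Set_cat_hom)
  have t_in: "t i g \<in> B" if "i \<in> Obj I" "g \<in> hom C A (on_obj D i)" for i g
    using t[OF that(1)] that(2) by auto
  show ?thesis
    unfolding is_cocone_def hom_compatible_def
    using B_obj t_hom t_in square by (simp add: hom_func_sel(1))
qed

text \<open>
  Removes the category of sets from the preservation of a colimit by \<open>hom(A, -)\<close>, leaving a universal
  property of functions on hom-sets.
\<close>

lemma hom_set_colimit_iff: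
  fixes C :: "('u, 'u) cat"
  assumes C: "class_category C" and A: "A \<in> Obj C" and D: "is_functor I C D" and c: "is_cocone I C D K c"
  shows "is_colimit I Set_cat (comp_func (hom_func C A) D) (on_obj (hom_func C A) K)
      (\<lambda>i. on_mor (hom_func C A) (c i)) \<longleftrightarrow>
    (\<forall>B \<delta>. small B \<longrightarrow> hom_compatible C A I D B \<delta> \<longrightarrow>
      (\<exists>!t. t \<in> hom C A K \<rightarrow>\<^sub>E B \<and>
        (\<forall>i \<in> Obj I. \<forall>g \<in> hom C A (on_obj D i). t (Comp C (c i) g) = \<delta> i g)))"
    (is "is_colimit I Set_cat ?H ?K ?c \<longleftrightarrow> (\<forall>B \<delta>. small B \<longrightarrow> _ B \<delta> \<longrightarrow> (\<exists>!t. ?fac B \<delta> t))")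
proof -
  have cat: "category C" using C by (rule class_categoryD)
  have K: "small (hom C A K)" using class_categoryD(2)[OF C A cocone_obj[OF c]] .
  have I: "Dom I u \<in> Obj I" "Cod I u \<in> Obj I" if "u \<in> Mor I" for u
    using D that by (auto simp: is_functor_def category_def)
  let ?r = "\<lambda>i. restrict (Comp C (c i)) (hom C A (on_obj D i))"
  have c_eq: "?c i = (hom C A (on_obj D i), ?r i, hom C A K)" if "i \<in> Obj I" for i
    using hom_func_sel(2)[OF cocone_hom[OF c that]] .
  have r: "?r i \<in> hom C A (on_obj D i) \<rightarrow>\<^sub>E hom C A K" if "i \<in> Obj I" for i
    using Comp_hom[OF cat _ cocone_hom[OF c that]] by auto
  have cocone_cong: "is_cocone I Set_cat ?H B d \<longleftrightarrow> is_cocone I Set_cat ?H B d'"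
    if "\<And>i. i \<in> Obj I \<Longrightarrow> d i = d' i" for B d d'
    using that I by (simp add: is_cocone_def)
  have Du: "on_mor D u \<in> hom C (on_obj D (Dom I u)) (on_obj D (Cod I u))" if "u \<in> Mor I" for u
    using D that by (simp add: is_functor_def)
  have "hom_compatible C A I D (hom C A K) ?r"
    unfolding hom_compatible_def
  proof (intro conjI ballI)
    fix u g assume u: "u \<in> Mor I" and g: "g \<in> hom C A (on_obj D (Dom I u))"
    show "?r (Cod I u) (Comp C (on_mor D u) g) = ?r (Dom I u) g"
      using Comp_hom[OF cat g Du[OF u]] g Comp_assoc[OF cat g Du[OF u] cocone_hom[OF c I(2)[OF u]]]
        cocone_commute[OF c Mor_hom[OF u]] by simp
  qed (use Comp_hom[OF cat _ cocone_hom[OF c]] in auto)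
  then have "is_cocone I Set_cat ?H (hom C A K) (\<lambda>i. (hom C A (on_obj D i), ?r i, hom C A K))"
    using hom_set_cocone_iff[OF C A D K r] by simp
  then have cocone: "is_cocone I Set_cat ?H ?K ?c"
    using cocone_cong[of ?c] c_eq by (simp add: hom_func_sel(1))
  have fac_iff: "(hom C A K, t, B) \<in> hom Set_cat ?K B \<and>
        (\<forall>i \<in> Obj I. Comp Set_cat (hom C A K, t, B) (?c i) = (hom C A (on_obj D i), restrict (\<delta> i) (hom C A (on_obj D i)), B)) \<longleftrightarrow>
      ?fac B \<delta> t" if B: "small B" for B \<delta> t
  proof -
    have "Comp Set_cat (hom C A K, t, B) (?c i) = (hom C A (on_obj D i), restrict (\<delta> i) (hom C A (on_obj D i)), B) \<longleftrightarrow>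
      (\<forall>g \<in> hom C A (on_obj D i). t (Comp C (c i) g) = \<delta> i g)" if "i \<in> Obj I" for i
      unfolding c_eq[OF that] Set_cat_Comp
      by (auto simp: compose_def restrict_def fun_eq_iff)
    then show ?thesis using B K by (simp add: Set_cat_hom hom_func_sel(1))
  qed
  have hom_triple: "u \<in> hom Set_cat ?K B \<Longrightarrow> \<exists>t. u = (hom C A K, t, B)" for u B
    by (auto simp: Set_cat_hom hom_func_sel(1))
  have ex1_iff: "(\<exists>!u. u \<in> hom Set_cat ?K B \<and> (\<forall>i \<in> Obj I. Comp Set_cat u (?c i) =
      (hom C A (on_obj D i), restrict (\<delta> i) (hom C A (on_obj D i)), B))) \<longleftrightarrow> (\<exists>!t. ?fac B \<delta> t)"
    (is "(\<exists>!u. ?P u) \<longleftrightarrow> _") if B: "small B" for B \<delta>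
  proof -
    have *: "?P (hom C A K, t, B) \<longleftrightarrow> ?fac B \<delta> t" for t using fac_iff[OF B] .
    show ?thesis
    proof
      assume "\<exists>!u. ?P u"
      then obtain u where u: "?P u" "\<And>v. ?P v \<Longrightarrow> v = u" by (elim ex1E) blast
      then obtain t where t: "u = (hom C A K, t, B)" using hom_triple by blast
      show "\<exists>!t. ?fac B \<delta> t"
      proof (rule ex1I[of _ t])
        show "?fac B \<delta> t" using u(1) unfolding t * .
        show "s = t" if "?fac B \<delta> s" for s using u(2)[of "(hom C A K, s, B)"] that unfolding * t by blast
      qed
    next
      assume "\<exists>!t. ?fac B \<delta> t"
      then obtain t where t: "?fac B \<delta> t" "\<And>s. ?fac B \<delta> s \<Longrightarrow> s = t" by (elim ex1E) blast
      show "\<exists>!u. ?P u"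
      proof (rule ex1I[of _ "(hom C A K, t, B)"])
        show "?P (hom C A K, t, B)" using t(1) unfolding * .
        show "v = (hom C A K, t, B)" if v: "?P v" for v
        proof -
          obtain s where s: "v = (hom C A K, s, B)" using hom_triple v by blast
          show ?thesis using t(2) v unfolding s * by blast
        qed
      qed
    qed
  qed
  have restr: "hom_compatible C A I D B (\<lambda>i. restrict (\<delta> i) (hom C A (on_obj D i))) \<longleftrightarrow> hom_compatible C A I D B \<delta>"
    for B \<delta>
    unfolding hom_compatible_def using Comp_hom[OF cat _ Du] by simp
  show ?thesis
  proof
    assume col: "is_colimit I Set_cat ?H ?K ?c"
    show "\<forall>B \<delta>. small B \<longrightarrow> hom_compatible C A I D B \<delta> \<longrightarrow> (\<exists>!t. ?fac B \<delta> t)"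
    proof (intro allI impI)
      fix B \<delta> assume B: "small B" and \<delta>: "hom_compatible C A I D B \<delta>"
      have "restrict (\<delta> i) (hom C A (on_obj D i)) \<in> hom C A (on_obj D i) \<rightarrow>\<^sub>E B" if "i \<in> Obj I" for i
        using \<delta> that by (auto simp: hom_compatible_def)
      then have "is_cocone I Set_cat ?H B (\<lambda>i. (hom C A (on_obj D i), restrict (\<delta> i) (hom C A (on_obj D i)), B))"
        using hom_set_cocone_iff[OF C A D B, of "\<lambda>i. restrict (\<delta> i) (hom C A (on_obj D i))"] \<delta> restr by blast
      then show "\<exists>!t. ?fac B \<delta> t"
        using col unfolding is_colimit_def ex1_iff[OF B, symmetric] by blast
    qed
  next
    assume fac: "\<forall>B \<delta>. small B \<longrightarrow> hom_compatible C A I D B \<delta> \<longrightarrow> (\<exists>!t. ?fac B \<delta> t)"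
    show "is_colimit I Set_cat ?H ?K ?c"
      unfolding is_colimit_def
    proof (intro conjI allI impI cocone)
      fix B d assume d: "is_cocone I Set_cat ?H B d"
      have B: "small B" using cocone_obj[OF d] by (simp add: Set_cat_def)
      have "\<forall>i \<in> Obj I. \<exists>t. d i = (hom C A (on_obj D i), t, B) \<and> t \<in> hom C A (on_obj D i) \<rightarrow>\<^sub>E B"
        using cocone_hom[OF d] by (simp add: Set_cat_hom hom_func_sel(1)) blast
      then obtain \<delta> where \<delta>: "\<And>i. i \<in> Obj I \<Longrightarrow> d i = (hom C A (on_obj D i), \<delta> i, B)"
        "\<And>i. i \<in> Obj I \<Longrightarrow> \<delta> i \<in> hom C A (on_obj D i) \<rightarrow>\<^sub>E B" by metis
      have "is_cocone I Set_cat ?H B (\<lambda>i. (hom C A (on_obj D i), \<delta> i, B))"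
        using d cocone_cong[of d] \<delta>(1) by simp
      then have "hom_compatible C A I D B \<delta>" using hom_set_cocone_iff[OF C A D B \<delta>(2)] by simp
      then have "\<exists>!t. ?fac B \<delta> t" using fac B by blast
      moreover have "restrict (\<delta> i) (hom C A (on_obj D i)) = \<delta> i" if "i \<in> Obj I" for i
        using \<delta>(2)[OF that] by (auto simp: PiE_def extensional_restrict)
      ultimately show "\<exists>!u. u \<in> hom Set_cat ?K B \<and> (\<forall>i \<in> Obj I. Comp Set_cat u (?c i) = d i)"
        unfolding ex1_iff[OF B, symmetric] using \<delta>(1) by simp
    qed
  qed
qed

text \<open>
  The concrete description of \<open>hom(A, K)\<close> as a filtered colimit of the sets \<open>hom(A, D i)\<close>: every morphism
  factors through a stage, and two factorisations through the same stage agree at a later one.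
\<close>

definition stagewise_hom ::
  "('u, 'u) cat \<Rightarrow> 'u \<Rightarrow> ('u, 'u) cat \<Rightarrow> ('u, 'u, 'u, 'u) func \<Rightarrow> 'u \<Rightarrow> ('u \<Rightarrow> 'u) \<Rightarrow> bool" where
  "stagewise_hom C A I D K c \<longleftrightarrow>
     (\<forall>f \<in> hom C A K. \<exists>i \<in> Obj I. \<exists>g \<in> hom C A (on_obj D i). Comp C (c i) g = f) \<and>
     (\<forall>i \<in> Obj I. \<forall>g \<in> hom C A (on_obj D i). \<forall>g' \<in> hom C A (on_obj D i).
        Comp C (c i) g = Comp C (c i) g' \<longrightarrow>
        (\<exists>j. \<exists>u \<in> hom I i j. Comp C (on_mor D u) g = Comp C (on_mor D u) g'))"

text \<open>
  Cocones into a set \<open>{a, b}\<close> suffice. For factorisation, the constant function and the indicator of a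
  morphism \<open>f\<close> that factors through no stage induce the same cocone, which contradicts uniqueness. For
  agreement, fix \<open>g\<close> at stage \<open>i\<close> and test whether a morphism at some stage meets \<open>g\<close> at a later stage.
  Filteredness makes this test a cocone, so its value depends only on the composite into \<open>K\<close>.
\<close>

lemma stagewise_if_hom_set_colimit:
  fixes C :: "('u, 'u) cat"
  assumes C: "class_category C" and A: "A \<in> Obj C" and \<kappa>: "Cinfinite (\<kappa> :: 'u rel)" "filtered \<kappa> I"
    and D: "is_functor I C D" and c: "is_cocone I C D K c"
    and universal: "\<And>B \<delta>. small B \<Longrightarrow> hom_compatible C A I D B \<delta> \<Longrightarrow>
      \<exists>!t. t \<in> hom C A K \<rightarrow>\<^sub>E B \<and> (\<forall>i \<in> Obj I. \<forall>g \<in> hom C A (on_obj D i). t (Comp C (c i) g) = \<delta> i g)"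
  shows "stagewise_hom C A I D K c"
proof -
  have cat: "category C" using C by (rule class_categoryD)
  have catI: "category I" using D by (simp add: is_functor_def)
  have inf: "infinite (UNIV :: 'u set)"
    using \<kappa>(1) by (rule infinite_UNIV_if_Cinfinite)
  obtain a b :: 'u where ab: "a \<noteq> b" using ex_new_if_finite[OF inf, of "{undefined}"] by (metis finite.simps singletonI)
  have two: "small {a, b}"
    unfolding small_def using inf card_of_Card_order[of "UNIV :: 'u set"]
    by (intro finite_less_Cinfinite) (auto simp: cinfinite_def Field_card_of)
  show ?thesis
    unfolding stagewise_hom_def
  proof (intro conjI ballI impI)
    fix f assume f: "f \<in> hom C A K"
    show "\<exists>i \<in> Obj I. \<exists>g \<in> hom C A (on_obj D i). Comp C (c i) g = f"
    proof (rule ccontr)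
      assume no: "\<not> ?thesis"
      let ?s = "restrict (\<lambda>_. a) (hom C A K)" and ?t = "restrict (\<lambda>h. if h = f then b else a) (hom C A K)"
      have comp: "Comp C (c i) g \<in> hom C A K" if "i \<in> Obj I" "g \<in> hom C A (on_obj D i)" for i g
        using Comp_hom[OF cat that(2) cocone_hom[OF c that(1)]] .
      have "hom_compatible C A I D {a, b} (\<lambda>_ _. a)" by (simp add: hom_compatible_def)
      note ex1 = universal[OF two this]
      have s: "?s \<in> hom C A K \<rightarrow>\<^sub>E {a, b} \<and> (\<forall>i \<in> Obj I. \<forall>g \<in> hom C A (on_obj D i). ?s (Comp C (c i) g) = a)"
        using comp by auto
      have t: "?t \<in> hom C A K \<rightarrow>\<^sub>E {a, b} \<and> (\<forall>i \<in> Obj I. \<forall>g \<in> hom C A (on_obj D i). ?t (Comp C (c i) g) = a)"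
        using comp no by auto
      have "?s = ?t" by (rule ex1E[OF ex1]) (metis (no_types, lifting) s t)
      from fun_cong[OF this, of f] show False using f ab by simp
    qed
  next
    fix i g g' assume i: "i \<in> Obj I" and g: "g \<in> hom C A (on_obj D i)" and g': "g' \<in> hom C A (on_obj D i)"
      and eq: "Comp C (c i) g = Comp C (c i) g'"
    let ?meets = "\<lambda>j h. \<exists>k. \<exists>u \<in> hom I i k. \<exists>v \<in> hom I j k. Comp C (on_mor D u) g = Comp C (on_mor D v) h"
    let ?\<delta> = "\<lambda>j h. if ?meets j h then a else b"
    have "hom_compatible C A I D {a, b} ?\<delta>"
      unfolding hom_compatible_def
    proof (intro conjI ballI)
      fix w h assume w: "w \<in> Mor I" and h: "h \<in> hom C A (on_obj D (Dom I w))"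
      note w' = Mor_hom[OF w]
      note Dw = functor_hom[OF D w']
      have "?meets (Cod I w) (Comp C (on_mor D w) h) \<longleftrightarrow> ?meets (Dom I w) h"
      proof
        assume "?meets (Cod I w) (Comp C (on_mor D w) h)"
        then obtain k u v where u: "u \<in> hom I i k" and v: "v \<in> hom I (Cod I w) k"
          and uv: "Comp C (on_mor D u) g = Comp C (on_mor D v) (Comp C (on_mor D w) h)" by blast
        have "Comp C (on_mor D v) (Comp C (on_mor D w) h) = Comp C (on_mor D (Comp I v w)) h"
          using Comp_assoc[OF cat h Dw functor_hom[OF D v]] functor_Comp[OF D w' v] by simp
        then show "?meets (Dom I w) h" using u Comp_hom[OF catI w' v] uv by metis
      next
        assume "?meets (Dom I w) h"
        then obtain k u v where u: "u \<in> hom I i k" and v: "v \<in> hom I (Dom I w) k"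
          and uv: "Comp C (on_mor D u) g = Comp C (on_mor D v) h" by blast
        obtain l p q where p: "p \<in> hom I k l" and q: "q \<in> hom I (Cod I w) l" and pq: "Comp I p v = Comp I q w"
          using filtered_square[OF \<kappa> v w'] by blast
        have "Comp C (on_mor D (Comp I p u)) g = Comp C (on_mor D p) (Comp C (on_mor D v) h)"
          using Comp_assoc[OF cat g functor_hom[OF D u] functor_hom[OF D p]] functor_Comp[OF D u p] uv by simp
        also have "\<dots> = Comp C (on_mor D (Comp I q w)) h"
          using Comp_assoc[OF cat h functor_hom[OF D v] functor_hom[OF D p]] functor_Comp[OF D v p] pq by simp
        also have "\<dots> = Comp C (on_mor D q) (Comp C (on_mor D w) h)"
          using Comp_assoc[OF cat h Dw functor_hom[OF D q]] functor_Comp[OF D w' q] by simp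
        finally show "?meets (Cod I w) (Comp C (on_mor D w) h)" using Comp_hom[OF catI u p] q by blast
      qed
      then show "?\<delta> (Cod I w) (Comp C (on_mor D w) h) = ?\<delta> (Dom I w) h" by simp
    qed simp
    from universal[OF two this] obtain t where
      t: "\<And>j h. j \<in> Obj I \<Longrightarrow> h \<in> hom C A (on_obj D j) \<Longrightarrow> t (Comp C (c j) h) = ?\<delta> j h"
      by (elim ex1E) blast
    have "?meets i g" using Id_hom[OF catI i] by blast
    then have "?\<delta> i g' = a" using t[OF i g] t[OF i g'] eq by simp
    then have "?meets i g'" using ab by (metis (no_types, lifting))
    then obtain k u v where u: "u \<in> hom I i k" and v: "v \<in> hom I i k"
      and uv: "Comp C (on_mor D u) g = Comp C (on_mor D v) g'" by blast
    \<comment> \<open>The two morphisms meet along different arrows; a coequalising arrow makes these the same.\<close>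
    obtain l w where w: "w \<in> hom I k l" and wuv: "Comp I w u = Comp I w v"
      using filtered_coequalise[OF \<kappa> u v] by blast
    have "Comp C (on_mor D (Comp I w u)) g = Comp C (on_mor D (Comp I w v)) g'"
      using Comp_assoc[OF cat g functor_hom[OF D u] functor_hom[OF D w]] functor_Comp[OF D u w]
        Comp_assoc[OF cat g' functor_hom[OF D v] functor_hom[OF D w]] functor_Comp[OF D v w] uv by simp
    then show "\<exists>j. \<exists>u \<in> hom I i j. Comp C (on_mor D u) g = Comp C (on_mor D u) g'"
      using wuv Comp_hom[OF catI u w] by metis
  qed
qed

lemma hom_set_colimit_if_stagewise:
  fixes C :: "('u, 'u) cat"
  assumes C: "class_category C" and A: "A \<in> Obj C" and \<kappa>: "Cinfinite (\<kappa> :: 'u rel)" "filtered \<kappa> I"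
    and D: "is_functor I C D" and c: "is_cocone I C D K c"
    and stage: "stagewise_hom C A I D K c" and \<delta>: "hom_compatible C A I D B \<delta>"
  shows "\<exists>!t. t \<in> hom C A K \<rightarrow>\<^sub>E B \<and> (\<forall>i \<in> Obj I. \<forall>g \<in> hom C A (on_obj D i). t (Comp C (c i) g) = \<delta> i g)"
proof -
  have cat: "category C" using C by (rule class_categoryD)
  have catI: "category I" using D by (simp add: is_functor_def)
  have move: "\<delta> j (Comp C (on_mor D u) g) = \<delta> i g" if "u \<in> hom I i j" "g \<in> hom C A (on_obj D i)" for i j u g
    using \<delta> that by (auto simp: hom_compatible_def hom_def)
  have push: "Comp C (c j) (Comp C (on_mor D u) g) = Comp C (c i) g"
    if "u \<in> hom I i j" "g \<in> hom C A (on_obj D i)" for i j u g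
    using Comp_assoc[OF cat that(2) functor_hom[OF D that(1)] cocone_hom[OF c hom_obj(2)[OF catI that(1)]]]
      cocone_commute[OF c that(1)] by simp
  have agree: "\<delta> i g = \<delta> j h"
    if i: "i \<in> Obj I" and j: "j \<in> Obj I" and g: "g \<in> hom C A (on_obj D i)" and h: "h \<in> hom C A (on_obj D j)"
      and eq: "Comp C (c i) g = Comp C (c j) h" for i j g h
  proof -
    obtain k u v where u: "u \<in> hom I i k" and v: "v \<in> hom I j k" using filtered_join[OF \<kappa> i j] by blast
    let ?g = "Comp C (on_mor D u) g" and ?h = "Comp C (on_mor D v) h"
    have gh: "?g \<in> hom C A (on_obj D k)" "?h \<in> hom C A (on_obj D k)"
      using Comp_hom[OF cat g functor_hom[OF D u]] Comp_hom[OF cat h functor_hom[OF D v]] by auto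
    have "Comp C (c k) ?g = Comp C (c k) ?h" using push[OF u g] push[OF v h] eq by simp
    then obtain l w where "w \<in> hom I k l" "Comp C (on_mor D w) ?g = Comp C (on_mor D w) ?h"
      using stage gh hom_obj(2)[OF catI u] unfolding stagewise_hom_def by blast
    then have "\<delta> k ?g = \<delta> k ?h" using move gh by metis
    then show ?thesis using move[OF u g] move[OF v h] by simp
  qed
  have "\<forall>f \<in> hom C A K. \<exists>b \<in> B. \<forall>i \<in> Obj I. \<forall>g \<in> hom C A (on_obj D i). Comp C (c i) g = f \<longrightarrow> \<delta> i g = b"
  proof
    fix f assume "f \<in> hom C A K"
    then obtain i g where "i \<in> Obj I" "g \<in> hom C A (on_obj D i)" "Comp C (c i) g = f"
      using stage unfolding stagewise_hom_def by blast
    then show "\<exists>b \<in> B. \<forall>i \<in> Obj I. \<forall>g \<in> hom C A (on_obj D i). Comp C (c i) g = f \<longrightarrow> \<delta> i g = b"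
      using agree \<delta> unfolding hom_compatible_def by (intro bexI[of _ "\<delta> i g"]) (metis, blast)
  qed
  then obtain t where t: "\<And>f. f \<in> hom C A K \<Longrightarrow> t f \<in> B"
    "\<And>f i g. f \<in> hom C A K \<Longrightarrow> i \<in> Obj I \<Longrightarrow> g \<in> hom C A (on_obj D i) \<Longrightarrow> Comp C (c i) g = f \<Longrightarrow> \<delta> i g = t f"
    by metis
  have comp: "Comp C (c i) g \<in> hom C A K" if "i \<in> Obj I" "g \<in> hom C A (on_obj D i)" for i g
    using Comp_hom[OF cat that(2) cocone_hom[OF c that(1)]] .
  show ?thesis
  proof (rule ex1I[of _ "restrict t (hom C A K)"])
    show "restrict t (hom C A K) \<in> hom C A K \<rightarrow>\<^sub>E B \<and>
        (\<forall>i \<in> Obj I. \<forall>g \<in> hom C A (on_obj D i). restrict t (hom C A K) (Comp C (c i) g) = \<delta> i g)"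
      using t(1) t(2)[OF comp _ _ refl, symmetric] comp by auto
  next
    fix s assume s: "s \<in> hom C A K \<rightarrow>\<^sub>E B \<and> (\<forall>i \<in> Obj I. \<forall>g \<in> hom C A (on_obj D i). s (Comp C (c i) g) = \<delta> i g)"
    show "s = restrict t (hom C A K)"
    proof (rule extensionalityI[of _ "hom C A K"])
      fix f assume f: "f \<in> hom C A K"
      then obtain i g where "i \<in> Obj I" "g \<in> hom C A (on_obj D i)" "Comp C (c i) g = f"
        using stage unfolding stagewise_hom_def by blast
      then show "s f = restrict t (hom C A K) f" using s t(2)[OF f] f by auto
    qed (use s in \<open>auto simp: PiE_def\<close>)
  qed
qed

lemma presentable_iff_stagewise:
  fixes C :: "('u, 'u) cat"
  assumes C: "class_category C" and \<kappa>: "Cinfinite (\<kappa> :: 'u rel)"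
  shows "presentable \<kappa> C A \<longleftrightarrow> A \<in> Obj C \<and>
    (\<forall>I D K c. filtered_diagram \<kappa> I C D \<longrightarrow> is_colimit I C D K c \<longrightarrow> stagewise_hom C A I D K c)"
proof -
  have "is_colimit I Set_cat (comp_func (hom_func C A) D) (on_obj (hom_func C A) K)
      (\<lambda>i. on_mor (hom_func C A) (c i)) \<longleftrightarrow> stagewise_hom C A I D K c"
    if A: "A \<in> Obj C" and D: "filtered_diagram \<kappa> I C D" and c: "is_colimit I C D K c" for I D K c
  proof -
    have I: "filtered \<kappa> I" and F: "is_functor I C D" using D by (auto simp: filtered_diagram_def)
    note cocone = colimit_cocone[OF c]
    show ?thesis
      unfolding hom_set_colimit_iff[OF C A F cocone]
    proof (intro iffI allI impI, goal_cases)
      case 1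
      show ?case by (rule stagewise_if_hom_set_colimit[OF C A \<kappa> I F cocone]) (rule 1[rule_format])
    next
      case (2 B \<delta>)
      show ?case by (rule hom_set_colimit_if_stagewise[OF C A \<kappa> I F cocone 2(1) 2(3)])
    qed
  qed
  then show ?thesis unfolding presentable_def preserves_filtered_colimits_def by blast
qed

lemma presentable_mono:
  fixes C :: "('u, 'u) cat"
  assumes "\<kappa> \<le>o \<mu>" "presentable \<kappa> C A"
  shows "presentable \<mu> C A"
  using assms(2) filtered_diagram_antimono[OF assms(1)]
  unfolding presentable_def preserves_filtered_colimits_def by meson

text \<open>
  A morphism out of \<open>A\<close> is treated as its composite with \<open>r\<close>, to which the presentability of \<open>B\<close> applies;
  composing with \<open>s\<close> recovers the original morphism.
\<close>

lemma presentable_retract: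
  fixes C :: "('u, 'u) cat"
  assumes C: "class_category C" and \<kappa>: "Cinfinite (\<kappa> :: 'u rel)" and B: "presentable \<kappa> C B"
    and s: "s \<in> hom C A B" and r: "r \<in> hom C B A" and rs: "Comp C r s = Id C A"
  shows "presentable \<kappa> C A"
  unfolding presentable_iff_stagewise[OF C \<kappa>]
proof (intro conjI allI impI)
  have cat: "category C" using C by (rule class_categoryD)
  show "A \<in> Obj C" using hom_obj(1)[OF cat s] .
  have split: "Comp C (Comp C g r) s = g" if "g \<in> hom C A E" for g E
    using Comp_assoc[OF cat s r that] rs Comp_Id[OF cat that] by simp
  fix I D K c assume D: "filtered_diagram \<kappa> I C D" and K: "is_colimit I C D K c"
  then have stage: "stagewise_hom C B I D K c" using B presentable_iff_stagewise[OF C \<kappa>] by blast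
  have F: "is_functor I C D" using D by (simp add: filtered_diagram_def)
  have ci: "c i \<in> hom C (on_obj D i) K" if "i \<in> Obj I" for i
    using cocone_hom[OF colimit_cocone[OF K] that] .
  show "stagewise_hom C A I D K c"
    unfolding stagewise_hom_def
  proof (intro conjI ballI impI)
    fix f assume f: "f \<in> hom C A K"
    obtain i g where i: "i \<in> Obj I" and g: "g \<in> hom C B (on_obj D i)" and eq: "Comp C (c i) g = Comp C f r"
      using stage Comp_hom[OF cat r f] unfolding stagewise_hom_def by blast
    have "Comp C (c i) (Comp C g s) = f"
      using Comp_assoc[OF cat s g ci[OF i]] eq split[OF f] by simp
    then show "\<exists>i \<in> Obj I. \<exists>g \<in> hom C A (on_obj D i). Comp C (c i) g = f"
      using i Comp_hom[OF cat s g] by blast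
  next
    fix i g g' assume i: "i \<in> Obj I" and g: "g \<in> hom C A (on_obj D i)" and g': "g' \<in> hom C A (on_obj D i)"
      and eq: "Comp C (c i) g = Comp C (c i) g'"
    have "Comp C (c i) (Comp C g r) = Comp C (c i) (Comp C g' r)"
      using Comp_assoc[OF cat r g ci[OF i]] Comp_assoc[OF cat r g' ci[OF i]] eq by simp
    then obtain j u where u: "u \<in> hom I i j"
      and uu: "Comp C (on_mor D u) (Comp C g r) = Comp C (on_mor D u) (Comp C g' r)"
      using stage i Comp_hom[OF cat r g] Comp_hom[OF cat r g'] unfolding stagewise_hom_def by blast
    note Du = functor_hom[OF F u]
    have "Comp C (on_mor D u) g = Comp C (on_mor D u) g'"
      using split[OF Comp_hom[OF cat g Du]] split[OF Comp_hom[OF cat g' Du]]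
        Comp_assoc[OF cat r g Du] Comp_assoc[OF cat r g' Du] uu by simp
    then show "\<exists>j. \<exists>u \<in> hom I i j. Comp C (on_mor D u) g = Comp C (on_mor D u) g'" using u by blast
  qed
qed

text \<open>
  In sets, \<open>\<mu>\<close>-filtered colimits commute with limits of fewer than \<open>\<mu>\<close> arrows; here this is carried out
  concretely. A morphism out of \<open>B\<close> is a compatible family of morphisms out of the \<open>D j\<close>. There are fewer
  than \<open>\<mu>\<close> of these and fewer than \<open>\<mu>\<close> compatibilities between them, so all of them can be realised at one
  common stage.
\<close>

lemma presentable_small_colimit:
  fixes C J :: "('u, 'u) cat"
  assumes C: "class_category C" and \<mu>: "Cinfinite (\<mu> :: 'u rel)"
    and D: "is_functor J C D" and J: "|Mor J| <o \<mu>"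
    and pres: "\<And>j. j \<in> Obj J \<Longrightarrow> presentable \<mu> C (on_obj D j)"
    and B: "is_colimit J C D B b"
  shows "presentable \<mu> C B"
  unfolding presentable_iff_stagewise[OF C \<mu>]
proof (intro conjI allI impI)
  have cat: "category C" using C by (rule class_categoryD)
  have catJ: "category J" using D by (simp add: is_functor_def)
  note cocB = colimit_cocone[OF B]
  show "B \<in> Obj C" using cocone_obj[OF cocB] .
  have bj: "b j \<in> hom C (on_obj D j) B" if "j \<in> Obj J" for j using cocone_hom[OF cocB that] .
  have mJ: "Dom J m \<in> Obj J" "Cod J m \<in> Obj J" if "m \<in> Mor J" for m using catJ that by (auto simp: category_def)
  have Dm: "on_mor D m \<in> hom C (on_obj D (Dom J m)) (on_obj D (Cod J m))" if "m \<in> Mor J" for m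
    using functor_hom[OF D Mor_hom[OF that]] .
  have ObjJ: "|Obj J| <o \<mu>"
  proof -
    have "Obj J \<subseteq> Dom J ` Mor J" using Id_hom[OF catJ] unfolding hom_def by force
    then show ?thesis using card_of_mono1 card_of_image J ordLeq_ordLess_trans by metis
  qed
  fix I E K c assume E: "filtered_diagram \<mu> I C E" and K: "is_colimit I C E K c"
  have F: "is_functor I C E" and I: "filtered \<mu> I" using E by (auto simp: filtered_diagram_def)
  have catI: "category I" using F by (simp add: is_functor_def)
  have ci: "c i \<in> hom C (on_obj E i) K" if "i \<in> Obj I" for i
    using cocone_hom[OF colimit_cocone[OF K] that] .
  have push: "Comp C (c j) (Comp C (on_mor E u) g) = Comp C (c i) g"
    if "u \<in> hom I i j" "g \<in> hom C A (on_obj E i)" for i j u g A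
    using Comp_assoc[OF cat that(2) functor_hom[OF F that(1)] ci[OF hom_obj(2)[OF catI that(1)]]]
      cocone_commute[OF colimit_cocone[OF K] that(1)] by simp
  have stage: "stagewise_hom C (on_obj D j) I E K c" if "j \<in> Obj J" for j
    using pres[OF that] presentable_iff_stagewise[OF C \<mu>] E K by blast
  \<comment> \<open>Fewer than \<open>\<mu>\<close> arrows out of \<open>i\<close> can be completed to one and the same composite \<open>w\<close>; the identity of \<open>i\<close> is added so that \<open>w\<close> exists even for an empty family.\<close>
  have star: "\<exists>k w. w \<in> hom I i k \<and> (\<forall>x \<in> X. \<exists>v \<in> hom I (t x) k. Comp I v (u x) = w)"
    if i: "i \<in> Obj I" and X: "|X| <o \<mu>" and u: "\<And>x. x \<in> X \<Longrightarrow> u x \<in> hom I i (t x)" for i X u and t :: "'u \<Rightarrow> 'u"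
  proof -
    let ?Y = "insert (Id I i) (u ` X)"
    have "?Y = {Id I i} \<union> u ` X" by simp
    moreover have "|u ` X| <o \<mu>" using X card_of_image ordLeq_ordLess_trans by blast
    ultimately have "|?Y| <o \<mu>"
      using \<mu> finite_less_Cinfinite[OF \<mu>, of "{Id I i}"]
      by (metis card_of_Un_ordLess_infinite_Field cinfinite_def finite.emptyI finite.insertI)
    moreover have "?Y \<subseteq> Mor I" using u Id_hom[OF catI i] by (auto simp: hom_def)
    ultimately obtain k w where w: "arrow_cocone I ?Y k w" using arrow_cocone_if_filtered[OF \<mu> I] by blast
    have "w i \<in> hom I i k" using w homD[OF Id_hom[OF catI i]] by (auto simp: arrow_cocone_def)
    moreover have "w (t x) \<in> hom I (t x) k \<and> Comp I (w (t x)) (u x) = w i" if "x \<in> X" for x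
      using w homD[OF u[OF that]] that by (auto simp: arrow_cocone_def)
    ultimately show ?thesis by blast
  qed
  show "stagewise_hom C B I E K c"
    unfolding stagewise_hom_def
  proof (intro conjI ballI impI)
    fix f assume f: "f \<in> hom C B K"
    have fb: "Comp C f (b j) \<in> hom C (on_obj D j) K" if "j \<in> Obj J" for j using Comp_hom[OF cat bj[OF that] f] .
    have "\<forall>j \<in> Obj J. \<exists>i g. i \<in> Obj I \<and> g \<in> hom C (on_obj D j) (on_obj E i) \<and> Comp C (c i) g = Comp C f (b j)"
      using stage fb unfolding stagewise_hom_def by blast
    then obtain i0 g0 where g0: "\<And>j. j \<in> Obj J \<Longrightarrow> i0 j \<in> Obj I"
      "\<And>j. j \<in> Obj J \<Longrightarrow> g0 j \<in> hom C (on_obj D j) (on_obj E (i0 j))"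
      "\<And>j. j \<in> Obj J \<Longrightarrow> Comp C (c (i0 j)) (g0 j) = Comp C f (b j)" by metis
    have "|i0 ` Obj J| <o \<mu>" using ObjJ card_of_image ordLeq_ordLess_trans by blast
    moreover have "i0 ` Obj J \<subseteq> Obj I" using g0(1) by blast
    ultimately obtain i v where i: "i \<in> Obj I" and v: "\<And>j. j \<in> Obj J \<Longrightarrow> v (i0 j) \<in> hom I (i0 j) i"
      using filtered_upper_bound[OF \<mu> I] by (metis imageI)
    \<comment> \<open>All components, moved to a common stage \<open>i\<close>; they commute with the arrows of \<open>J\<close> only after going to \<open>K\<close>.\<close>
    define g where "g j = Comp C (on_mor E (v (i0 j))) (g0 j)" for j
    have g: "g j \<in> hom C (on_obj D j) (on_obj E i)" "Comp C (c i) (g j) = Comp C f (b j)" if "j \<in> Obj J" for j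
      using Comp_hom[OF cat g0(2) functor_hom[OF F v]] push[OF v g0(2)] g0(3) that by (auto simp: g_def)
    have "\<exists>k. \<exists>u \<in> hom I i k. Comp C (on_mor E u) (Comp C (g (Cod J m)) (on_mor D m)) = Comp C (on_mor E u) (g (Dom J m))"
      if m: "m \<in> Mor J" for m
    proof -
      have "Comp C (c i) (Comp C (g (Cod J m)) (on_mor D m)) = Comp C f (Comp C (b (Cod J m)) (on_mor D m))"
        using Comp_assoc[OF cat Dm[OF m] g(1)[OF mJ(2)[OF m]] ci[OF i]] g(2)[OF mJ(2)[OF m]]
          Comp_assoc[OF cat Dm[OF m] bj[OF mJ(2)[OF m]] f] by simp
      also have "\<dots> = Comp C (c i) (g (Dom J m))"
        using cocone_commute[OF cocB Mor_hom[OF m]] g(2)[OF mJ(1)[OF m]] by simp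
      finally show ?thesis
        using stage[OF mJ(1)[OF m]] i g(1)[OF mJ(1)[OF m]] Comp_hom[OF cat Dm[OF m] g(1)[OF mJ(2)[OF m]]]
        unfolding stagewise_hom_def by blast
    qed
    then obtain t u where u: "\<And>m. m \<in> Mor J \<Longrightarrow> u m \<in> hom I i (t m)"
      "\<And>m. m \<in> Mor J \<Longrightarrow> Comp C (on_mor E (u m)) (Comp C (g (Cod J m)) (on_mor D m)) = Comp C (on_mor E (u m)) (g (Dom J m))"
      by metis
    obtain k w where w: "w \<in> hom I i k" and wv: "\<And>m. m \<in> Mor J \<Longrightarrow> \<exists>v \<in> hom I (t m) k. Comp I v (u m) = w"
      using star[OF i J, of u t] u(1) by blast
    note Ew = functor_hom[OF F w]
    let ?g = "\<lambda>j. Comp C (on_mor E w) (g j)"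
    have "is_cocone J C D (on_obj E k) ?g"
      unfolding is_cocone_def
    proof (intro conjI ballI)
      fix m assume m: "m \<in> Mor J"
      note gD = g(1)[OF mJ(1)[OF m]] and gC = g(1)[OF mJ(2)[OF m]]
      obtain v where v: "v \<in> hom I (t m) k" "Comp I v (u m) = w" using wv[OF m] by blast
      note Eu = functor_hom[OF F u(1)[OF m]] and Ev = functor_hom[OF F v(1)]
      have Ew_eq: "on_mor E w = Comp C (on_mor E v) (on_mor E (u m))"
        using functor_Comp[OF F u(1)[OF m] v(1)] v(2) by simp
      have "Comp C (?g (Cod J m)) (on_mor D m) = Comp C (on_mor E w) (Comp C (g (Cod J m)) (on_mor D m))"
        using Comp_assoc[OF cat Dm[OF m] gC Ew] by simp
      also have "\<dots> = Comp C (on_mor E v) (Comp C (on_mor E (u m)) (Comp C (g (Cod J m)) (on_mor D m)))"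
        unfolding Ew_eq using Comp_assoc[OF cat Comp_hom[OF cat Dm[OF m] gC] Eu Ev] by simp
      also have "\<dots> = ?g (Dom J m)"
        unfolding Ew_eq u(2)[OF m] using Comp_assoc[OF cat gD Eu Ev] by simp
      finally show "Comp C (?g (Cod J m)) (on_mor D m) = ?g (Dom J m)" .
    next
      show "on_obj E k \<in> Obj C" using hom_obj(2)[OF cat Ew] .
      show "?g j \<in> hom C (on_obj D j) (on_obj E k)" if "j \<in> Obj J" for j
        using Comp_hom[OF cat g(1)[OF that] Ew] .
    qed
    then obtain h where h: "h \<in> hom C B (on_obj E k)" "\<And>j. j \<in> Obj J \<Longrightarrow> Comp C h (b j) = ?g j"
      using colimit_factor[OF B] by blast
    note k = hom_obj(2)[OF catI w]
    have "Comp C (c k) h = f"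
    proof (rule colimit_jointly_epi[OF cat D B Comp_hom[OF cat h(1) ci[OF k]] f])
      fix j assume j: "j \<in> Obj J"
      show "Comp C (Comp C (c k) h) (b j) = Comp C f (b j)"
        using Comp_assoc[OF cat bj[OF j] h(1) ci[OF k]] h(2)[OF j] push[OF w g(1)[OF j]] g(2)[OF j] by simp
    qed
    then show "\<exists>i \<in> Obj I. \<exists>g \<in> hom C B (on_obj E i). Comp C (c i) g = f" using k h(1) by blast
  next
    fix i g g' assume i: "i \<in> Obj I" and g: "g \<in> hom C B (on_obj E i)" and g': "g' \<in> hom C B (on_obj E i)"
      and eq: "Comp C (c i) g = Comp C (c i) g'"
    have "\<exists>k. \<exists>u \<in> hom I i k. Comp C (on_mor E u) (Comp C g (b j)) = Comp C (on_mor E u) (Comp C g' (b j))"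
      if j: "j \<in> Obj J" for j
    proof -
      have "Comp C (c i) (Comp C g (b j)) = Comp C (c i) (Comp C g' (b j))"
        using Comp_assoc[OF cat bj[OF j] g ci[OF i]] Comp_assoc[OF cat bj[OF j] g' ci[OF i]] eq by simp
      then show ?thesis
        using stage[OF j] i Comp_hom[OF cat bj[OF j] g] Comp_hom[OF cat bj[OF j] g']
        unfolding stagewise_hom_def by blast
    qed
    then obtain t u where u: "\<And>j. j \<in> Obj J \<Longrightarrow> u j \<in> hom I i (t j)"
      "\<And>j. j \<in> Obj J \<Longrightarrow> Comp C (on_mor E (u j)) (Comp C g (b j)) = Comp C (on_mor E (u j)) (Comp C g' (b j))"
      by metis
    obtain k w where w: "w \<in> hom I i k" and wv: "\<And>j. j \<in> Obj J \<Longrightarrow> \<exists>v \<in> hom I (t j) k. Comp I v (u j) = w"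
      using star[OF i ObjJ, of u t] u(1) by blast
    note Ew = functor_hom[OF F w]
    have "Comp C (on_mor E w) g = Comp C (on_mor E w) g'"
    proof (rule colimit_jointly_epi[OF cat D B Comp_hom[OF cat g Ew] Comp_hom[OF cat g' Ew]])
      fix j assume j: "j \<in> Obj J"
      obtain v where v: "v \<in> hom I (t j) k" "Comp I v (u j) = w" using wv[OF j] by blast
      note Eu = functor_hom[OF F u(1)[OF j]] and Ev = functor_hom[OF F v(1)]
      have Ew_eq: "on_mor E w = Comp C (on_mor E v) (on_mor E (u j))"
        using functor_Comp[OF F u(1)[OF j] v(1)] v(2) by simp
      have split: "Comp C (Comp C (on_mor E w) h) (b j) = Comp C (on_mor E v) (Comp C (on_mor E (u j)) (Comp C h (b j)))"
        if h: "h \<in> hom C B (on_obj E i)" for h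
        using Comp_assoc[OF cat bj[OF j] h Ew] Comp_assoc[OF cat Comp_hom[OF cat bj[OF j] h] Eu Ev] Ew_eq by simp
      show "Comp C (Comp C (on_mor E w) g) (b j) = Comp C (Comp C (on_mor E w) g') (b j)"
        using split[OF g] split[OF g'] u(2)[OF j] by simp
    qed
    then show "\<exists>j. \<exists>u \<in> hom I i j. Comp C (on_mor E u) g = Comp C (on_mor E u) g'" using w by blast
  qed
qed

section \<open>Refining a filtered colimit\<close>

definition arrow_subcategory :: "('o, 'm) cat \<Rightarrow> 'm set \<Rightarrow> ('o, 'm) cat" where
  "arrow_subcategory I M = I\<lparr>Obj := {i \<in> Obj I. Id I i \<in> M}, Mor := M\<rparr>"

text \<open>
  The arrow sets of the \<open>\<kappa>\<close>-filtered subcategories of \<open>I\<close>, which need not be full. Fullness is avoided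
  because a full subcategory on few objects can have too many arrows.
\<close>

definition saturated :: "'u rel \<Rightarrow> ('u, 'u) cat \<Rightarrow> 'u set \<Rightarrow> bool" where
  "saturated \<kappa> I M \<longleftrightarrow> M \<subseteq> Mor I \<and>
     (\<forall>f \<in> M. Id I (Dom I f) \<in> M \<and> Id I (Cod I f) \<in> M) \<and>
     (\<forall>f \<in> M. \<forall>g \<in> M. Cod I f = Dom I g \<longrightarrow> Comp I g f \<in> M) \<and>
     (\<forall>X. X \<subseteq> M \<longrightarrow> |X| <o \<kappa> \<longrightarrow>
       (\<exists>A c. arrow_cocone I X A c \<and> Id I A \<in> M \<and> (\<forall>f \<in> X. c (Dom I f) \<in> M \<and> c (Cod I f) \<in> M)))"

lemma arrow_subcategory_sel [simp]:
  "Obj (arrow_subcategory I M) = {i \<in> Obj I. Id I i \<in> M}" "Mor (arrow_subcategory I M) = M"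
  "Dom (arrow_subcategory I M) = Dom I" "Cod (arrow_subcategory I M) = Cod I"
  "Id (arrow_subcategory I M) = Id I" "Comp (arrow_subcategory I M) = Comp I"
  by (simp_all add: arrow_subcategory_def)

lemma category_arrow_subcategory:
  assumes I: "category I" and M: "saturated \<kappa> I M"
  shows "category (arrow_subcategory I M)"
proof -
  have MI: "f \<in> Mor I" if "f \<in> M" for f using M that by (auto simp: saturated_def)
  show ?thesis
    unfolding category_def
  proof (intro conjI ballI impI)
    fix f g assume "f \<in> Mor (arrow_subcategory I M)" "g \<in> Mor (arrow_subcategory I M)"
      "Cod (arrow_subcategory I M) f = Dom (arrow_subcategory I M) g"
    then show "Comp (arrow_subcategory I M) g f \<in> hom (arrow_subcategory I M)
        (Dom (arrow_subcategory I M) f) (Cod (arrow_subcategory I M) g)"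
      using M MI Comp_hom[OF I Mor_hom[of f I], of g] by (auto simp: saturated_def hom_def)
  qed (use I M MI in \<open>auto simp: saturated_def category_def hom_def\<close>)
qed

lemma filtered_arrow_subcategory:
  assumes I: "category I" and M: "saturated \<kappa> I M"
  shows "filtered \<kappa> (arrow_subcategory I M)"
proof (rule filtered_if_arrow_cocones[OF category_arrow_subcategory[OF assms]])
  fix X assume "X \<subseteq> Mor (arrow_subcategory I M)" "|X| <o \<kappa>"
  then obtain A c where c: "arrow_cocone I X A c" "Id I A \<in> M" "\<And>f. f \<in> X \<Longrightarrow> c (Dom I f) \<in> M \<and> c (Cod I f) \<in> M"
    using M unfolding saturated_def by auto
  then have "arrow_cocone (arrow_subcategory I M) X A c"
    by (auto simp: arrow_cocone_def hom_def)
  then show "\<exists>A c. arrow_cocone (arrow_subcategory I M) X A c" by blast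
qed

lemma functor_arrow_subcategory:
  assumes D: "is_functor I C D" and M: "saturated \<kappa> I M"
  shows "is_functor (arrow_subcategory I M) C D"
proof -
  have "f \<in> Mor I" if "f \<in> M" for f using M that by (auto simp: saturated_def)
  moreover have "category I" using D by (simp add: is_functor_def)
  ultimately show ?thesis
    using D category_arrow_subcategory[OF _ M] unfolding is_functor_def by simp
qed

lemma filtered_diagram_arrow_subcategory:
  assumes D: "filtered_diagram \<kappa> I C D" and M: "saturated \<kappa> I M"
  shows "filtered_diagram \<kappa> (arrow_subcategory I M) C D"
proof -
  have I: "category I" "small (Obj I)" "small (Mor I)" "is_functor I C D"
    using D by (auto simp: filtered_diagram_def small_category_def)
  have "M \<subseteq> Mor I" using M by (simp add: saturated_def)
  then show ?thesis
    unfolding filtered_diagram_def small_category_def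
    using category_arrow_subcategory[OF I(1) M] filtered_arrow_subcategory[OF I(1) M]
      functor_arrow_subcategory[OF I(4) M] small_subset[OF I(3)] small_subset[OF I(2), of "{i \<in> Obj I. Id I i \<in> M}"]
    by auto
qed

text \<open>
  Saturation, and closure under \<open>h\<close>, is closure under an operation on sets of fewer than \<open>\<kappa>\<close> arrows: add
  a chosen cocone, the identities, the composites and the values of \<open>h\<close>.
\<close>

lemma exists_saturated_superset:
  fixes \<kappa> \<mu> :: "'u rel"
  assumes \<kappa>: "regular_cardinal \<kappa>" and \<mu>: "regular_cardinal \<mu>" and sharp: "sharply_below \<kappa> \<mu>"
    and I: "filtered \<kappa> I" and M0: "M0 \<subseteq> Mor I" "|M0| <o \<mu>" and h: "\<And>f. f \<in> Mor I \<Longrightarrow> h f \<in> Mor I"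
  shows "\<exists>M. M0 \<subseteq> M \<and> |M| <o \<mu> \<and> saturated \<kappa> I M \<and> h ` M \<subseteq> M"
proof -
  note regular_cardinalD[OF \<kappa>] and regular_cardinalD[OF \<mu>]
  have cat: "category I" using I by (simp add: filtered_def)
  have "\<forall>X. \<exists>A c. X \<subseteq> Mor I \<longrightarrow> |X| <o \<kappa> \<longrightarrow> arrow_cocone I X A c"
    using arrow_cocone_if_filtered[OF \<open>Cinfinite \<kappa>\<close> I] by blast
  then obtain A c where c: "\<And>X. X \<subseteq> Mor I \<Longrightarrow> |X| <o \<kappa> \<Longrightarrow> arrow_cocone I X (A X) (c X)" by metis
  define H where "H X = Id I ` insert (A X) (Dom I ` X \<union> Cod I ` X) \<union> c X ` (Dom I ` X \<union> Cod I ` X) \<union>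
    (\<lambda>(g, f). Comp I g f) ` {(g, f) \<in> X \<times> X. Cod I f = Dom I g} \<union> h ` X" for X
  have H_Mor: "H X \<subseteq> Mor I" if X: "X \<subseteq> Mor I" "|X| <o \<kappa>" for X
  proof -
    have *: "Dom I f \<in> Obj I" "Cod I f \<in> Obj I" if "f \<in> X" for f
      using that X(1) cat by (auto simp: category_def)
    have id: "Id I i \<in> Mor I" if "i \<in> Obj I" for i using homD(1)[OF Id_hom[OF cat that]] .
    have cX: "c X (Dom I f) \<in> Mor I" "c X (Cod I f) \<in> Mor I" if "f \<in> X" for f
      using c[OF X] that by (auto simp: arrow_cocone_def hom_def)
    have "A X \<in> Obj I" using c[OF X] by (simp add: arrow_cocone_def)
    then have "Id I ` insert (A X) (Dom I ` X \<union> Cod I ` X) \<subseteq> Mor I"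
      using * id by auto
    moreover have "c X ` (Dom I ` X \<union> Cod I ` X) \<subseteq> Mor I"
      using cX by auto
    moreover have "(\<lambda>(g, f). Comp I g f) ` {(g, f) \<in> X \<times> X. Cod I f = Dom I g} \<subseteq> Mor I"
    proof clarsimp
      fix g f assume gf: "g \<in> X" "f \<in> X" "Cod I f = Dom I g"
      have "f \<in> hom I (Dom I f) (Dom I g)" "g \<in> hom I (Dom I g) (Cod I g)"
        using gf X(1) by (auto simp: hom_def)
      from homD(1)[OF Comp_hom[OF cat this]] show "Comp I g f \<in> Mor I" .
    qed
    moreover have "h ` X \<subseteq> Mor I" using X(1) h by blast
    ultimately show ?thesis by (simp add: H_def)
  qed
  have H_small: "|H X| <o \<mu>" if "|X| <o \<kappa>" for X
  proof -
    have X: "|X| <o \<mu>" using that sharp ordLess_transitive unfolding sharply_below_def by blast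
    have im: "|g ` Y| <o \<mu>" if "|Y| <o \<mu>" for g :: "'b \<Rightarrow> 'u" and Y
      using that card_of_image ordLeq_ordLess_trans by blast
    have un: "|Y \<union> Z| <o \<mu>" if "|Y| <o \<mu>" "|Z| <o \<mu>" for Y Z :: "'u set"
      using that \<open>Card_order \<mu>\<close> \<open>infinite (Field \<mu>)\<close> by (intro card_of_Un_ordLess_infinite_Field)
    have ends: "|Dom I ` X \<union> Cod I ` X| <o \<mu>" using X im un by blast
    have "|{A X} \<union> (Dom I ` X \<union> Cod I ` X)| <o \<mu>"
      by (intro un ends finite_less_Cinfinite[OF \<open>Cinfinite \<mu>\<close>]) simp
    then have "|insert (A X) (Dom I ` X \<union> Cod I ` X)| <o \<mu>" by simp
    moreover have "|{(g, f) \<in> X \<times> X. Cod I f = Dom I g}| <o \<mu>"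
    proof -
      have "|X \<times> X| <o \<mu>"
        by (rule Times_less_regular[OF \<open>Cinfinite \<mu>\<close> \<open>regularCard \<mu>\<close> X X])
      moreover have "|{(g, f) \<in> X \<times> X. Cod I f = Dom I g}| \<le>o |X \<times> X|" by (rule card_of_mono1) auto
      ultimately show ?thesis using ordLeq_ordLess_trans by blast
    qed
    ultimately show ?thesis unfolding H_def using X ends by (intro un im)
  qed
  have "\<exists>N. M0 \<subseteq> N \<and> |N| <o \<mu> \<and> (\<forall>X. X \<subseteq> N \<longrightarrow> |X| <o \<kappa> \<longrightarrow> H X \<subseteq> N)"
    by (rule exists_closed_superset[OF \<kappa> \<mu> sharp M0(2)]) (rule H_small)
  then obtain N where N: "M0 \<subseteq> N" "|N| <o \<mu>" "\<And>X. X \<subseteq> N \<Longrightarrow> |X| <o \<kappa> \<Longrightarrow> H X \<subseteq> N"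
    by auto
  \<comment> \<open>Nothing keeps the closed set \<open>N\<close> inside \<open>Mor I\<close>; cutting it down preserves closure, since \<open>H\<close> maps sets of arrows to sets of arrows.\<close>
  define M where "M = N \<inter> Mor I"
  have H_M: "H X \<subseteq> M" if X: "X \<subseteq> M" "|X| <o \<kappa>" for X
    using N(3)[of X] H_Mor[of X] X by (auto simp: M_def)
  have fin: "|X| <o \<kappa>" if "finite X" for X :: "'u set" using finite_less_Cinfinite[OF \<open>Cinfinite \<kappa>\<close> that] .
  have M_Mor: "M \<subseteq> Mor I" by (simp add: M_def)
  have "saturated \<kappa> I M"
    unfolding saturated_def
  proof (intro conjI ballI impI allI M_Mor)
    fix f assume f: "f \<in> M"
    then have "H {f} \<subseteq> M" using H_M[of "{f}"] fin by simp
    then show "Id I (Dom I f) \<in> M" "Id I (Cod I f) \<in> M" by (auto simp: H_def)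
    fix g assume "g \<in> M" "Cod I f = Dom I g"
    then have "H {f, g} \<subseteq> M" "Comp I g f \<in> H {f, g}" using f H_M[of "{f, g}"] fin by (auto simp: H_def)
    then show "Comp I g f \<in> M" by blast
  next
    fix X assume X: "X \<subseteq> M" "|X| <o \<kappa>"
    have "arrow_cocone I X (A X) (c X)" using c X M_Mor by blast
    moreover have "H X \<subseteq> M" using H_M X .
    ultimately show "\<exists>A c. arrow_cocone I X A c \<and> Id I A \<in> M \<and> (\<forall>f \<in> X. c (Dom I f) \<in> M \<and> c (Cod I f) \<in> M)"
      by (intro exI[of _ "A X"] exI[of _ "c X"]) (auto simp: H_def)
  qed
  moreover have "h ` M \<subseteq> M"
  proof clarify
    fix f assume "f \<in> M"
    then show "h f \<in> M" using H_M[of "{f}"] fin[of "{f}"] by (auto simp: H_def)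
  qed
  moreover have "|M| <o \<mu>" by (rule ordLeq_ordLess_trans[OF card_of_mono1 N(2)]) (simp add: M_def)
  moreover have "M0 \<subseteq> M" using N(1) M0(1) by (simp add: M_def)
  ultimately show ?thesis by blast
qed

text \<open>
  The family \<open>\<P>\<close> ordered by inclusion, as a category. Objects and morphisms must be elements of the
  universe, so \<open>e\<close> codes the members of \<open>\<P>\<close> and \<open>p\<close> codes pairs.
\<close>

definition inclusion_cat :: "('u set \<Rightarrow> 'u) \<Rightarrow> ('u \<times> 'u \<Rightarrow> 'u) \<Rightarrow> 'u set set \<Rightarrow> ('u, 'u) cat" where
  "inclusion_cat e p \<P> = \<lparr>Obj = e ` \<P>,
     Mor = {p (e M, e N) |M N. M \<in> \<P> \<and> N \<in> \<P> \<and> M \<subseteq> N},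
     Dom = (\<lambda>m. fst (inv p m)), Cod = (\<lambda>m. snd (inv p m)),
     Id = (\<lambda>a. p (a, a)),
     Comp = (\<lambda>g f. p (fst (inv p f), snd (inv p g)))\<rparr>"

lemma inclusion_cat_sel:
  assumes "inj p"
  shows "Obj (inclusion_cat e p \<P>) = e ` \<P>"
    "Mor (inclusion_cat e p \<P>) = {p (e M, e N) |M N. M \<in> \<P> \<and> N \<in> \<P> \<and> M \<subseteq> N}"
    "Dom (inclusion_cat e p \<P>) (p (a, b)) = a" "Cod (inclusion_cat e p \<P>) (p (a, b)) = b"
    "Id (inclusion_cat e p \<P>) a = p (a, a)"
    "Comp (inclusion_cat e p \<P>) (p (b', c)) (p (a, b)) = p (a, c)"
  using assms by (simp_all add: inclusion_cat_def)

lemma category_inclusion_cat: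
  assumes p: "inj p" and e: "inj_on e \<P>"
  shows "category (inclusion_cat e p \<P>)"
proof -
  note sel = inclusion_cat_sel[OF p]
  have e_eq: "e M = e N \<longleftrightarrow> M = N" if "M \<in> \<P>" "N \<in> \<P>" for M N using e that by (auto simp: inj_on_def)
  have MorE: "\<exists>M N. M \<in> \<P> \<and> N \<in> \<P> \<and> M \<subseteq> N \<and> f = p (e M, e N)" if "f \<in> Mor (inclusion_cat e p \<P>)" for f
    using that by (auto simp: sel)
  show ?thesis
    unfolding category_def
  proof (intro conjI ballI impI)
    fix f g assume fg: "f \<in> Mor (inclusion_cat e p \<P>)" "g \<in> Mor (inclusion_cat e p \<P>)"
      "Cod (inclusion_cat e p \<P>) f = Dom (inclusion_cat e p \<P>) g"
    obtain M N N' L where f: "M \<in> \<P>" "N \<in> \<P>" "M \<subseteq> N" "f = p (e M, e N)"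
      and g: "N' \<in> \<P>" "L \<in> \<P>" "N' \<subseteq> L" "g = p (e N', e L)" using MorE[OF fg(1)] MorE[OF fg(2)] by blast
    have "N = N'" using fg(3) f g by (simp add: sel e_eq)
    then have "M \<subseteq> L" using f g by blast
    then show "Comp (inclusion_cat e p \<P>) g f \<in> hom (inclusion_cat e p \<P>)
        (Dom (inclusion_cat e p \<P>) f) (Cod (inclusion_cat e p \<P>) g)"
      using f g by (auto simp: sel hom_def)
    fix h assume h: "h \<in> Mor (inclusion_cat e p \<P>)"
    then obtain L' O' where "h = p (e L', e O')" using MorE by blast
    then show "Comp (inclusion_cat e p \<P>) h (Comp (inclusion_cat e p \<P>) g f) =
        Comp (inclusion_cat e p \<P>) (Comp (inclusion_cat e p \<P>) h g) f"
      using f g by (simp add: sel)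
  next
    fix f assume "f \<in> Mor (inclusion_cat e p \<P>)"
    then obtain M N where f: "M \<in> \<P>" "N \<in> \<P>" "M \<subseteq> N" "f = p (e M, e N)" using MorE by blast
    then show "Dom (inclusion_cat e p \<P>) f \<in> Obj (inclusion_cat e p \<P>)"
      "Cod (inclusion_cat e p \<P>) f \<in> Obj (inclusion_cat e p \<P>)"
      "Comp (inclusion_cat e p \<P>) f (Id (inclusion_cat e p \<P>) (Dom (inclusion_cat e p \<P>) f)) = f"
      "Comp (inclusion_cat e p \<P>) (Id (inclusion_cat e p \<P>) (Cod (inclusion_cat e p \<P>) f)) f = f"
      by (auto simp: sel)
  next
    fix a assume "a \<in> Obj (inclusion_cat e p \<P>)"
    then show "Id (inclusion_cat e p \<P>) a \<in> hom (inclusion_cat e p \<P>) a a" by (auto simp: sel hom_def)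
  qed
qed

lemma small_category_inclusion_cat:
  fixes e :: "'u set \<Rightarrow> 'u"
  assumes p: "inj p" and e: "inj_on e \<P>" and \<P>: "|\<P>| <o |UNIV :: 'u set|"
    and universe: "inaccessible |UNIV :: 'u set|" and inf: "infinite (UNIV :: 'u set)"
  shows "small_category (inclusion_cat e p \<P>)"
proof -
  have "Mor (inclusion_cat e p \<P>) \<subseteq> (\<lambda>(M, N). p (e M, e N)) ` (\<P> \<times> \<P>)"
    by (auto simp: inclusion_cat_sel[OF p])
  then have "|Mor (inclusion_cat e p \<P>)| \<le>o |(\<lambda>(M, N). p (e M, e N)) ` (\<P> \<times> \<P>)|" by (rule card_of_mono1)
  also have "|(\<lambda>(M, N). p (e M, e N)) ` (\<P> \<times> \<P>)| \<le>o |\<P> \<times> \<P>|" by (rule card_of_image)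
  finally have "|Mor (inclusion_cat e p \<P>)| \<le>o |\<P> \<times> \<P>|" .
  moreover have "|\<P> \<times> \<P>| <o |UNIV :: 'u set|"
    by (rule Times_less_regular[OF _ _ \<P> \<P>])
      (use universe inf in \<open>auto simp: inaccessible_def cinfinite_def Field_card_of\<close>)
  ultimately have "small (Mor (inclusion_cat e p \<P>))"
    unfolding small_def using ordLeq_ordLess_trans by blast
  moreover have "small (Obj (inclusion_cat e p \<P>))"
    unfolding small_def inclusion_cat_sel[OF p] using card_of_image \<P> ordLeq_ordLess_trans by blast
  ultimately show ?thesis using category_inclusion_cat[OF p e] by (simp add: small_category_def)
qed

lemma filtered_inclusion_cat:
  fixes e :: "'u set \<Rightarrow> 'u" and \<mu> :: "'u rel"
  assumes p: "inj p" and e: "inj_on e \<P>"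
    and directed: "\<And>\<X>. \<X> \<subseteq> \<P> \<Longrightarrow> |\<X>| <o \<mu> \<Longrightarrow> \<exists>M \<in> \<P>. \<Union>\<X> \<subseteq> M" and \<mu>: "Cinfinite \<mu>"
  shows "filtered \<mu> (inclusion_cat e p \<P>)"
proof (rule filtered_if_arrow_cocones[OF category_inclusion_cat[OF p e]])
  note sel = inclusion_cat_sel[OF p]
  fix X assume X: "X \<subseteq> Mor (inclusion_cat e p \<P>)" "|X| <o \<mu>"
  let ?d = "inv_into \<P> e"
  let ?V = "Dom (inclusion_cat e p \<P>) ` X \<union> Cod (inclusion_cat e p \<P>) ` X"
  have d: "?d (e M) = M" if "M \<in> \<P>" for M using e that by simp
  have XE: "\<exists>M N. M \<in> \<P> \<and> N \<in> \<P> \<and> M \<subseteq> N \<and> f = p (e M, e N)" if "f \<in> X" for f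
    using subsetD[OF X(1) that] unfolding sel by blast
  have V: "?V \<subseteq> e ` \<P>"
  proof -
    have "Dom (inclusion_cat e p \<P>) f \<in> e ` \<P>" "Cod (inclusion_cat e p \<P>) f \<in> e ` \<P>" if "f \<in> X" for f
      using XE[OF that] by (auto simp: sel)
    then show ?thesis by blast
  qed
  have "|?V| <o \<mu>"
  proof -
    have "|g ` X| <o \<mu>" for g :: "'u \<Rightarrow> 'u" using X(2) card_of_image ordLeq_ordLess_trans by blast
    then show ?thesis using \<mu> by (intro card_of_Un_ordLess_infinite_Field) (auto simp: cinfinite_def)
  qed
  then have "|?d ` ?V| <o \<mu>" using card_of_image ordLeq_ordLess_trans by blast
  moreover have "?d ` ?V \<subseteq> \<P>" using V by (auto dest!: subsetD[OF V] simp: d)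
  ultimately obtain L where L: "L \<in> \<P>" "\<Union>(?d ` ?V) \<subseteq> L" using directed by metis
  have "arrow_cocone (inclusion_cat e p \<P>) X (e L) (\<lambda>a. p (a, e L))"
    unfolding arrow_cocone_def
  proof (intro conjI ballI)
    fix f assume f: "f \<in> X"
    then obtain M N where MN: "M \<in> \<P>" "N \<in> \<P>" "M \<subseteq> N" "f = p (e M, e N)" using XE by blast
    have "Cod (inclusion_cat e p \<P>) f \<in> ?V" using f by blast
    moreover have "Cod (inclusion_cat e p \<P>) f = e N" unfolding MN(4) sel ..
    ultimately have "?d (e N) \<in> ?d ` ?V" by simp
    then have "?d (e N) \<subseteq> L" using L(2) by (rule subset_trans[OF Union_upper])
    then have "N \<subseteq> L" using d[OF MN(2)] by simp
    then show "p (Dom (inclusion_cat e p \<P>) f, e L) \<in> hom (inclusion_cat e p \<P>) (Dom (inclusion_cat e p \<P>) f) (e L)"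
      "p (Cod (inclusion_cat e p \<P>) f, e L) \<in> hom (inclusion_cat e p \<P>) (Cod (inclusion_cat e p \<P>) f) (e L)"
      "Comp (inclusion_cat e p \<P>) (p (Cod (inclusion_cat e p \<P>) f, e L)) f = p (Dom (inclusion_cat e p \<P>) f, e L)"
      using MN L(1) by (auto simp: sel hom_def)
  qed (use L(1) in \<open>simp add: sel\<close>)
  then show "\<exists>A c. arrow_cocone (inclusion_cat e p \<P>) X A c" by blast
qed

text \<open>
  The index category of the new diagram is the poset \<open>\<P>\<close> of saturated arrow sets \<open>M\<close> of size less than
  \<open>\<mu>\<close> that are closed under \<open>h\<close>; it is \<open>\<mu>\<close>-directed because fewer than \<open>\<mu>\<close> arrows always lie in a member
  of it. The diagram sends \<open>M\<close> to the colimit of \<open>D\<close> restricted to \<open>M\<close>, which exists because \<open>M\<close> is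
  \<open>\<kappa>\<close>-filtered. The members of \<open>\<P>\<close> exhaust \<open>I\<close>, so a cocone on the new diagram is the same as one on
  \<open>D\<close>. The operation \<open>h\<close> is free, so that the subdiagrams can be made to contain prescribed arrows.
\<close>

lemma refine_filtered_colimit:
  fixes \<kappa> \<mu> :: "'u rel" and C I :: "('u, 'u) cat"
  assumes universe: "inaccessible |UNIV :: 'u set|"
    and \<kappa>: "regular_cardinal \<kappa>" and \<mu>: "regular_cardinal \<mu>" and sharp: "sharply_below \<kappa> \<mu>"
    and C: "category C" "has_filtered_colimits \<kappa> C"
    and D: "filtered_diagram \<kappa> I C D" and K: "is_colimit I C D K c"
    and h: "\<And>f. f \<in> Mor I \<Longrightarrow> h f \<in> Mor I"
  shows "\<exists>P E d. filtered_diagram \<mu> P C E \<and> is_colimit P C E K d \<and>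
    (\<forall>p \<in> Obj P. \<exists>M b. |M| <o \<mu> \<and> saturated \<kappa> I M \<and> h ` M \<subseteq> M \<and>
      is_colimit (arrow_subcategory I M) C D (on_obj E p) b)"
proof -
  note regular_cardinalD[OF \<kappa>] and regular_cardinalD[OF \<mu>]
  note cat = C(1)
  have I: "filtered \<kappa> I" "category I" "small (Mor I)" and F: "is_functor I C D"
    using D by (auto simp: filtered_diagram_def small_category_def)
  note cocK = colimit_cocone[OF K]
  have inf: "infinite (UNIV :: 'u set)"
    using \<open>Cinfinite \<kappa>\<close> by (rule infinite_UNIV_if_Cinfinite)
  define \<P> where "\<P> = {M. |M| <o \<mu> \<and> saturated \<kappa> I M \<and> h ` M \<subseteq> M}"
  have \<P>D: "|M| <o \<mu>" "saturated \<kappa> I M" "M \<subseteq> Mor I" if "M \<in> \<P>" for M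
    using that by (auto simp: \<P>_def saturated_def)
  have \<P>_small: "|\<P>| <o |UNIV :: 'u set|"
  proof -
    have "|Pow (Mor I)| <o |UNIV :: 'u set|" using universe I(3) by (simp add: inaccessible_def small_def)
    moreover have "|\<P>| \<le>o |Pow (Mor I)|" using \<P>D(3) by (intro card_of_mono1) blast
    ultimately show ?thesis using ordLeq_ordLess_trans by blast
  qed
  obtain e :: "'u set \<Rightarrow> 'u" where e: "inj_on e \<P>"
    using ordLess_imp_ordLeq[OF \<P>_small] card_of_ordLeq[of \<P> "UNIV :: 'u set"] by auto
  obtain p :: "'u \<times> 'u \<Rightarrow> 'u" where p: "inj p" using exists_pairing[OF inf] by blast
  have superset: "\<exists>M \<in> \<P>. M0 \<subseteq> M" if "M0 \<subseteq> Mor I" "|M0| <o \<mu>" for M0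
  proof -
    have "\<exists>M. M0 \<subseteq> M \<and> |M| <o \<mu> \<and> saturated \<kappa> I M \<and> h ` M \<subseteq> M"
      by (rule exists_saturated_superset[OF \<kappa> \<mu> sharp I(1) that]) (rule h)
    then show ?thesis unfolding \<P>_def by blast
  qed
  have directed: "\<exists>M \<in> \<P>. \<Union>\<X> \<subseteq> M" if "\<X> \<subseteq> \<P>" "|\<X>| <o \<mu>" for \<X>
  proof (rule superset)
    show "\<Union>\<X> \<subseteq> Mor I" using that(1) \<P>D(3) by blast
    have "|\<Union>M \<in> \<X>. M| <o \<mu>"
      by (rule regularCard_UNION_bound[OF \<open>Cinfinite \<mu>\<close> \<open>regularCard \<mu>\<close> that(2)]) (rule \<P>D(1)[OF subsetD[OF that(1)]])
    then show "|\<Union>\<X>| <o \<mu>" by simp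
  qed
  define P where "P = inclusion_cat e p \<P>"
  note sel = inclusion_cat_sel[OF p, where e = e and \<P> = \<P>, folded P_def]
  have P: "small_category P" "filtered \<mu> P"
    unfolding P_def
    using small_category_inclusion_cat[OF p e \<P>_small universe inf]
      filtered_inclusion_cat[OF p e directed \<open>Cinfinite \<mu>\<close>] by auto
  define \<tau> where "\<tau> = inv_into \<P> e"
  have \<tau>: "\<tau> (e M) = M" if "M \<in> \<P>" for M using e that by (simp add: \<tau>_def)
  let ?S = "arrow_subcategory I"
  have FS: "is_functor (?S M) C D" if "M \<in> \<P>" for M using functor_arrow_subcategory[OF F \<P>D(2)[OF that]] .
  have "\<forall>M \<in> \<P>. \<exists>B b. is_colimit (?S M) C D B b"
    using C(2) filtered_diagram_arrow_subcategory[OF D \<P>D(2)] unfolding has_filtered_colimits_def by blast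
  then obtain B b where B: "\<And>M. M \<in> \<P> \<Longrightarrow> is_colimit (?S M) C D (B M) (b M)" by metis
  note cocB = colimit_cocone[OF B]
  have b: "b M i \<in> hom C (on_obj D i) (B M)" if "M \<in> \<P>" "i \<in> Obj (?S M)" for M i
    using cocone_hom[OF cocB[OF that(1)] that(2)] .
  have restrict_cocone: "is_cocone (?S M) C D A x" if "M \<in> \<P>" "M \<subseteq> N" "is_cocone (?S N) C D A x" for M N A x
    using that unfolding is_cocone_def by auto
  have restrict_cocone_I: "is_cocone (?S M) C D A x" if "M \<in> \<P>" "is_cocone I C D A x" for M A x
    using that \<P>D(3)[OF that(1)] unfolding is_cocone_def by auto
  have "\<exists>t. t \<in> hom C (B M) (B N) \<and> (\<forall>i \<in> Obj (?S M). Comp C t (b M i) = b N i)"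
    if "M \<in> \<P>" "N \<in> \<P>" "M \<subseteq> N" for M N
    using colimit_factor[OF B[OF that(1)] restrict_cocone[OF that(1,3) cocB[OF that(2)]]] by blast
  then obtain t where t: "\<And>M N. M \<in> \<P> \<Longrightarrow> N \<in> \<P> \<Longrightarrow> M \<subseteq> N \<Longrightarrow> t M N \<in> hom C (B M) (B N)"
    and tb: "\<And>M N i. M \<in> \<P> \<Longrightarrow> N \<in> \<P> \<Longrightarrow> M \<subseteq> N \<Longrightarrow> i \<in> Obj (?S M) \<Longrightarrow> Comp C (t M N) (b M i) = b N i"
    by metis
  have "\<exists>k. k \<in> hom C (B M) K \<and> (\<forall>i \<in> Obj (?S M). Comp C k (b M i) = c i)" if "M \<in> \<P>" for M
    using colimit_factor[OF B[OF that] restrict_cocone_I[OF that cocK]] by blast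
  then obtain k where k: "\<And>M. M \<in> \<P> \<Longrightarrow> k M \<in> hom C (B M) K"
    and kb: "\<And>M i. M \<in> \<P> \<Longrightarrow> i \<in> Obj (?S M) \<Longrightarrow> Comp C (k M) (b M i) = c i" by metis
  have epi: "x = y" if "M \<in> \<P>" "x \<in> hom C (B M) A" "y \<in> hom C (B M) A"
    "\<And>i. i \<in> Obj (?S M) \<Longrightarrow> Comp C x (b M i) = Comp C y (b M i)" for M x y A
    using colimit_jointly_epi[OF cat FS[OF that(1)] B[OF that(1)] that(2-4)] .
  have sub_obj: "i \<in> Obj (?S N)" if "M \<subseteq> N" "i \<in> Obj (?S M)" for M N i using that by auto
  have t_id: "t M M = Id C (B M)" if M: "M \<in> \<P>" for M
  proof (rule epi[OF M t[OF M M subset_refl]])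
    have BM: "B M \<in> Obj C" using cocone_obj[OF cocB[OF M]] .
    show "Id C (B M) \<in> hom C (B M) (B M)" using Id_hom[OF cat BM] .
    show "Comp C (t M M) (b M i) = Comp C (Id C (B M)) (b M i)" if "i \<in> Obj (?S M)" for i
      using tb[OF M M subset_refl that] Id_Comp[OF cat b[OF M that]] by simp
  qed
  have t_comp: "t M L = Comp C (t N L) (t M N)" if "M \<in> \<P>" "N \<in> \<P>" "L \<in> \<P>" "M \<subseteq> N" "N \<subseteq> L" for M N L
  proof (rule epi[OF that(1)])
    have M_L: "M \<subseteq> L" using that(4,5) by blast
    show "t M L \<in> hom C (B M) (B L)" using t[OF that(1,3) M_L] .
    show "Comp C (t N L) (t M N) \<in> hom C (B M) (B L)"
      using Comp_hom[OF cat t[OF that(1,2,4)] t[OF that(2,3,5)]] .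
    show "Comp C (t M L) (b M i) = Comp C (Comp C (t N L) (t M N)) (b M i)" if i: "i \<in> Obj (?S M)" for i
      using tb[OF \<open>M \<in> \<P>\<close> \<open>L \<in> \<P>\<close> M_L i] tb[OF \<open>M \<in> \<P>\<close> \<open>N \<in> \<P>\<close> \<open>M \<subseteq> N\<close> i]
        tb[OF \<open>N \<in> \<P>\<close> \<open>L \<in> \<P>\<close> \<open>N \<subseteq> L\<close> sub_obj[OF \<open>M \<subseteq> N\<close> i]]
        Comp_assoc[OF cat b[OF \<open>M \<in> \<P>\<close> i] t[OF \<open>M \<in> \<P>\<close> \<open>N \<in> \<P>\<close> \<open>M \<subseteq> N\<close>] t[OF \<open>N \<in> \<P>\<close> \<open>L \<in> \<P>\<close> \<open>N \<subseteq> L\<close>]]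
      by simp
  qed
  have k_t: "Comp C (k N) (t M N) = k M" if M: "M \<in> \<P>" and N: "N \<in> \<P>" and MN: "M \<subseteq> N" for M N
  proof (rule epi[OF M Comp_hom[OF cat t[OF M N MN] k[OF N]] k[OF M]])
    fix i assume i: "i \<in> Obj (?S M)"
    show "Comp C (Comp C (k N) (t M N)) (b M i) = Comp C (k M) (b M i)"
      using Comp_assoc[OF cat b[OF M i] t[OF M N MN] k[OF N]] tb[OF M N MN i] kb[OF N sub_obj[OF MN i]] kb[OF M i]
      by simp
  qed
  define E :: "('u, 'u, 'u, 'u) func" where
    "E = \<lparr>on_obj = (\<lambda>a. B (\<tau> a)), on_mor = (\<lambda>m. t (\<tau> (Dom P m)) (\<tau> (Cod P m)))\<rparr>"
  have E_obj: "on_obj E (e M) = B M" if "M \<in> \<P>" for M using that by (simp add: E_def \<tau>)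
  have E_mor: "on_mor E (p (e M, e N)) = t M N" if "M \<in> \<P>" "N \<in> \<P>" for M N
    using that by (simp add: E_def sel \<tau>)
  have MorE: "\<exists>M N. M \<in> \<P> \<and> N \<in> \<P> \<and> M \<subseteq> N \<and> f = p (e M, e N)" if "f \<in> Mor P" for f
    using that unfolding sel by blast
  have e_eq: "e M = e N \<longleftrightarrow> M = N" if "M \<in> \<P>" "N \<in> \<P>" for M N using e that by (auto simp: inj_on_def)
  have catP: "category P" using P(1) by (simp add: small_category_def)
  have EF: "is_functor P C E"
    unfolding is_functor_def
  proof (intro conjI ballI impI catP cat)
    fix f assume f: "f \<in> Mor P"
    then obtain M N where MN: "M \<in> \<P>" "N \<in> \<P>" "M \<subseteq> N" "f = p (e M, e N)" using MorE by blast
    then show "on_mor E f \<in> hom C (on_obj E (Dom P f)) (on_obj E (Cod P f))"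
      using t by (simp add: sel E_obj E_mor)
    fix g assume g: "g \<in> Mor P" "Cod P f = Dom P g"
    then obtain N' L where "N' \<in> \<P>" and L: "L \<in> \<P>" "N' \<subseteq> L" "g = p (e N', e L)" using MorE by blast
    moreover then have "N' = N" using g(2) MN by (simp add: sel e_eq)
    ultimately show "on_mor E (Comp P g f) = Comp C (on_mor E g) (on_mor E f)"
      using t_comp[of M N L] MN by (simp add: sel E_mor)
  next
    fix a assume "a \<in> Obj P"
    then obtain M where M: "M \<in> \<P>" "a = e M" by (auto simp: sel)
    then show "on_obj E a \<in> Obj C" "on_mor E (Id P a) = Id C (on_obj E a)"
      using t_id cocone_obj[OF cocB] by (simp_all add: sel E_obj E_mor)
  qed
  have "is_colimit P C E K (\<lambda>a. k (\<tau> a))"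
  proof (rule colimitI)
    show "is_cocone P C E K (\<lambda>a. k (\<tau> a))"
      unfolding is_cocone_def
    proof (intro conjI ballI)
      show "K \<in> Obj C" using cocone_obj[OF cocK] .
      show "k (\<tau> a) \<in> hom C (on_obj E a) K" if "a \<in> Obj P" for a
        using that k by (auto simp: sel E_obj \<tau>)
      fix f assume "f \<in> Mor P"
      then obtain M N where "M \<in> \<P>" "N \<in> \<P>" "M \<subseteq> N" "f = p (e M, e N)" using MorE by blast
      then show "Comp C (k (\<tau> (Cod P f))) (on_mor E f) = k (\<tau> (Dom P f))"
        using k_t by (simp add: sel E_mor \<tau>)
    qed
    have cover: "\<exists>M \<in> \<P>. f \<in> M" if "f \<in> Mor I" for f
      using superset[of "{f}"] that finite_less_Cinfinite[OF \<open>Cinfinite \<mu>\<close>, of "{f}"] by auto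
    have cover_obj: "\<exists>M \<in> \<P>. i \<in> Obj (?S M)" if "i \<in> Obj I" for i
      using cover[of "Id I i"] homD(1)[OF Id_hom[OF I(2) that]] that by auto
    show "x = y" if x: "x \<in> hom C K A" and y: "y \<in> hom C K A"
      and eq: "\<And>a. a \<in> Obj P \<Longrightarrow> Comp C x (k (\<tau> a)) = Comp C y (k (\<tau> a))" for A x y
    proof (rule colimit_jointly_epi[OF cat F K x y])
      fix i assume "i \<in> Obj I"
      then obtain M where M: "M \<in> \<P>" and i: "i \<in> Obj (?S M)" using cover_obj by blast
      have "Comp C x (k M) = Comp C y (k M)" using eq[of "e M"] M \<tau>[OF M] by (simp add: sel)
      then show "Comp C x (c i) = Comp C y (c i)"
        using kb[OF M i] Comp_assoc[OF cat b[OF M i] k[OF M] x] Comp_assoc[OF cat b[OF M i] k[OF M] y] by simp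
    qed
    fix A d assume d: "is_cocone P C E A d"
    define d' where "d' M = d (e M)" for M
    have d': "d' M \<in> hom C (B M) A" if "M \<in> \<P>" for M
      using cocone_hom[OF d, of "e M"] that by (simp add: sel E_obj d'_def)
    have d't: "Comp C (d' N) (t M N) = d' M" if "M \<in> \<P>" "N \<in> \<P>" "M \<subseteq> N" for M N
    proof -
      have "p (e M, e N) \<in> hom P (e M) (e N)" using that by (auto simp: sel hom_def)
      from cocone_commute[OF d this] show ?thesis using that by (simp add: E_mor d'_def)
    qed
    \<comment> \<open>Every \<open>M\<close> that contains \<open>i\<close> defines the same morphism \<open>D i \<rightarrow> A\<close>: compare two of them inside a common upper bound.\<close>
    have agree: "Comp C (d' M) (b M i) = Comp C (d' N) (b N i)"
      if M: "M \<in> \<P>" and N: "N \<in> \<P>" and i: "i \<in> Obj (?S M)" "i \<in> Obj (?S N)" for M N i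
    proof -
      have "|{M, N}| <o \<mu>" using finite_less_Cinfinite[OF \<open>Cinfinite \<mu>\<close>, of "{M, N}"] by simp
      then obtain L where L: "L \<in> \<P>" "M \<subseteq> L" "N \<subseteq> L" using directed[of "{M, N}"] M N by auto
      have "Comp C (d' M) (b M i) = Comp C (d' L) (b L i)"
        using Comp_assoc[OF cat b[OF M i(1)] t[OF M L(1,2)] d'[OF L(1)]] d't[OF M L(1,2)] tb[OF M L(1,2) i(1)] by simp
      moreover have "Comp C (d' N) (b N i) = Comp C (d' L) (b L i)"
        using Comp_assoc[OF cat b[OF N i(2)] t[OF N L(1,3)] d'[OF L(1)]] d't[OF N L(1,3)] tb[OF N L(1,3) i(2)] by simp
      ultimately show ?thesis by simp
    qed
    obtain m where m: "\<And>i. i \<in> Obj I \<Longrightarrow> m i \<in> \<P>" "\<And>i. i \<in> Obj I \<Longrightarrow> i \<in> Obj (?S (m i))"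
      using cover_obj by metis
    have "is_cocone I C D A (\<lambda>i. Comp C (d' (m i)) (b (m i) i))"
      unfolding is_cocone_def
    proof (intro conjI ballI)
      show "A \<in> Obj C" using cocone_obj[OF d] .
      show "Comp C (d' (m i)) (b (m i) i) \<in> hom C (on_obj D i) A" if "i \<in> Obj I" for i
        using Comp_hom[OF cat b d'] m[OF that] by blast
      fix f assume f: "f \<in> Mor I"
      then obtain M where M: "M \<in> \<P>" "f \<in> M" using cover by blast
      have ij: "Dom I f \<in> Obj I" "Cod I f \<in> Obj I" using f I(2) by (auto simp: category_def)
      have ijM: "Dom I f \<in> Obj (?S M)" "Cod I f \<in> Obj (?S M)"
        using ij M(2) \<P>D(2)[OF M(1)] by (auto simp: saturated_def)
      have fM: "f \<in> hom (?S M) (Dom I f) (Cod I f)" using M(2) by (simp add: hom_def)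
      have "Comp C (Comp C (d' M) (b M (Cod I f))) (on_mor D f) = Comp C (d' M) (b M (Dom I f))"
        using Comp_assoc[OF cat functor_hom[OF F Mor_hom[OF f]] b[OF M(1) ijM(2)] d'[OF M(1)]]
          cocone_commute[OF cocB[OF M(1)] fM] by simp
      then show "Comp C (Comp C (d' (m (Cod I f))) (b (m (Cod I f)) (Cod I f))) (on_mor D f) =
          Comp C (d' (m (Dom I f))) (b (m (Dom I f)) (Dom I f))"
        using agree[OF m(1)[OF ij(1)] M(1) m(2)[OF ij(1)] ijM(1)]
          agree[OF m(1)[OF ij(2)] M(1) m(2)[OF ij(2)] ijM(2)] by simp
    qed
    then obtain u where u: "u \<in> hom C K A" "\<And>i. i \<in> Obj I \<Longrightarrow> Comp C u (c i) = Comp C (d' (m i)) (b (m i) i)"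
      using colimit_factor[OF K] by blast
    have "Comp C u (k M) = d' M" if M: "M \<in> \<P>" for M
    proof (rule epi[OF M Comp_hom[OF cat k[OF M] u(1)] d'[OF M]])
      fix i assume i: "i \<in> Obj (?S M)"
      then have iI: "i \<in> Obj I" by simp
      show "Comp C (Comp C u (k M)) (b M i) = Comp C (d' M) (b M i)"
        using Comp_assoc[OF cat b[OF M i] k[OF M] u(1)] kb[OF M i] u(2)[OF iI] agree[OF m(1)[OF iI] M m(2)[OF iI] i]
        by simp
    qed
    then show "\<exists>u \<in> hom C K A. \<forall>a \<in> Obj P. Comp C u (k (\<tau> a)) = d a"
      using u(1) by (intro bexI[of _ u]) (auto simp: sel \<tau> d'_def)
  qed
  moreover have "filtered_diagram \<mu> P C E" using P EF by (simp add: filtered_diagram_def)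
  moreover have "\<forall>a \<in> Obj P. \<exists>M b. |M| <o \<mu> \<and> saturated \<kappa> I M \<and> h ` M \<subseteq> M \<and>
      is_colimit (?S M) C D (on_obj E a) b"
  proof
    fix a assume "a \<in> Obj P"
    then obtain M where M: "M \<in> \<P>" "a = e M" by (auto simp: sel)
    then have "|M| <o \<mu>" "saturated \<kappa> I M" "h ` M \<subseteq> M" by (auto simp: \<P>_def)
    then show "\<exists>M b. |M| <o \<mu> \<and> saturated \<kappa> I M \<and> h ` M \<subseteq> M \<and> is_colimit (?S M) C D (on_obj E a) b"
      using B[OF M(1)] M by (intro exI[of _ M] exI[of _ "b M"]) (simp add: E_obj)
  qed
  ultimately show ?thesis by blast
qed

section \<open>Full subcategories closed under filtered colimits\<close>

lemma has_filtered_colimits_mono: "\<kappa> \<le>o \<mu> \<Longrightarrow> has_filtered_colimits \<kappa> C \<Longrightarrow> has_filtered_colimits \<mu> C"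
  unfolding has_filtered_colimits_def by (meson filtered_diagram_antimono)

lemma preserves_filtered_colimits_mono:
  "\<kappa> \<le>o \<mu> \<Longrightarrow> preserves_filtered_colimits \<kappa> C E F \<Longrightarrow> preserves_filtered_colimits \<mu> C E F"
  unfolding preserves_filtered_colimits_def by (meson filtered_diagram_antimono)

lemma comp_func_inclusion [simp]: "comp_func inclusion D = (D :: ('i, 'j, 'o, 'm) func)"
  by (cases D) (simp add: comp_func_def inclusion_def comp_def)

lemma full_subcategory_sel [simp]:
  "Obj (full_subcategory C S) = {A \<in> Obj C. A \<in> S}"
  "Mor (full_subcategory C S) = {f \<in> Mor C. Dom C f \<in> S \<and> Cod C f \<in> S}"
  "Dom (full_subcategory C S) = Dom C" "Cod (full_subcategory C S) = Cod C"
  "Id (full_subcategory C S) = Id C" "Comp (full_subcategory C S) = Comp C"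
  by (simp_all add: full_subcategory_def)

lemma hom_full_subcategory: "A \<in> S \<Longrightarrow> B \<in> S \<Longrightarrow> hom (full_subcategory C S) A B = hom C A B"
  by (auto simp: hom_def)

lemma class_category_full_subcategory:
  assumes C: "class_category C"
  shows "class_category (full_subcategory C S)"
proof -
  have cat: "category C" using C by (rule class_categoryD)
  have "category (full_subcategory C S)"
    unfolding category_def
  proof (intro conjI ballI impI)
    fix f g assume "f \<in> Mor (full_subcategory C S)" "g \<in> Mor (full_subcategory C S)"
      "Cod (full_subcategory C S) f = Dom (full_subcategory C S) g"
    then show "Comp (full_subcategory C S) g f \<in>
        hom (full_subcategory C S) (Dom (full_subcategory C S) f) (Cod (full_subcategory C S) g)"
      using Comp_hom[OF cat Mor_hom[of f C], of g] by (auto simp: hom_def)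
  qed (use cat in \<open>auto simp: category_def hom_def\<close>)
  moreover have "small (hom (full_subcategory C S) A B)"
    if "A \<in> Obj (full_subcategory C S)" "B \<in> Obj (full_subcategory C S)" for A B
    using that C by (simp add: hom_full_subcategory class_category_def)
  ultimately show ?thesis by (simp add: class_category_def)
qed

lemma functor_into_full_subcategory_iff:
  assumes C: "class_category C"
  shows "is_functor I (full_subcategory C S) D \<longleftrightarrow> is_functor I C D \<and> (\<forall>i \<in> Obj I. on_obj D i \<in> S)"
proof -
  have "category C" "category (full_subcategory C S)"
    using class_categoryD(1) C class_category_full_subcategory[OF C] by blast+
  moreover have "Dom I f \<in> Obj I \<and> Cod I f \<in> Obj I" if "category I" "f \<in> Mor I" for f
    using that by (simp add: category_def)
  ultimately show ?thesis
    unfolding is_functor_def by (auto simp: hom_full_subcategory)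
qed

lemma filtered_diagram_full_subcategory_iff:
  assumes "class_category C"
  shows "filtered_diagram \<kappa> I (full_subcategory C S) D \<longleftrightarrow> filtered_diagram \<kappa> I C D \<and> (\<forall>i \<in> Obj I. on_obj D i \<in> S)"
  unfolding filtered_diagram_def functor_into_full_subcategory_iff[OF assms] by blast

lemma cocone_full_subcategory_iff:
  assumes "\<forall>i \<in> Obj I. on_obj D i \<in> S"
  shows "is_cocone I (full_subcategory C S) D A c \<longleftrightarrow> is_cocone I C D A c \<and> A \<in> S"
  using assms unfolding is_cocone_def by (auto simp: hom_full_subcategory)

lemma colimit_full_subcategory_if_colimit:
  assumes D: "\<forall>i \<in> Obj I. on_obj D i \<in> S" and A: "A \<in> S" and c: "is_colimit I C D A c"
  shows "is_colimit I (full_subcategory C S) D A c"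
  using c A unfolding is_colimit_def cocone_full_subcategory_iff[OF D] by (auto simp: hom_full_subcategory)

text \<open>
  The colimit \<open>B\<close> formed in \<open>C\<close> lies in the subcategory by closure and is a colimit there as well, so it
  is isomorphic to \<open>A\<close> by the comparison morphisms \<open>u\<close> and \<open>v\<close>.
\<close>

lemma colimit_if_colimit_full_subcategory:
  assumes C: "class_category C" and colim: "has_filtered_colimits \<kappa> C"
    and closed: "closed_under_filtered_colimits \<kappa> (full_subcategory C S) C"
    and D: "filtered_diagram \<kappa> I (full_subcategory C S) D"
    and c: "is_colimit I (full_subcategory C S) D A c"
  shows "is_colimit I C D A c"
proof -
  have cat: "category C" using C by (rule class_categoryD)
  have DC: "filtered_diagram \<kappa> I C D" and DS: "\<forall>i \<in> Obj I. on_obj D i \<in> S"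
    using D filtered_diagram_full_subcategory_iff[OF C] by blast+
  have F: "is_functor I C D" using DC by (simp add: filtered_diagram_def)
  obtain B b where b: "is_colimit I C D B b" using colim DC unfolding has_filtered_colimits_def by blast
  have B: "B \<in> S" using closed D b unfolding closed_under_filtered_colimits_def by auto
  have cocA: "is_cocone I C D A c" and A: "A \<in> S"
    using colimit_cocone[OF c] cocone_full_subcategory_iff[OF DS] by blast+
  note cocB = colimit_cocone[OF b]
  have ci: "c i \<in> hom C (on_obj D i) A" "b i \<in> hom C (on_obj D i) B" if "i \<in> Obj I" for i
    using cocone_hom[OF cocA that] cocone_hom[OF cocB that] .
  obtain u where u: "u \<in> hom C B A" "\<And>i. i \<in> Obj I \<Longrightarrow> Comp C u (b i) = c i"
    using colimit_factor[OF b cocA] by blast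
  have "is_cocone I (full_subcategory C S) D B b" using cocB B cocone_full_subcategory_iff[OF DS] by blast
  from colimit_factor[OF c this] obtain v where v: "v \<in> hom C A B" "\<And>i. i \<in> Obj I \<Longrightarrow> Comp C v (c i) = b i"
    using A B by (auto simp: hom_full_subcategory)
  have AA: "A \<in> Obj C" using cocone_obj[OF cocA] .
  have uv: "Comp C u v = Id C A"
  proof (rule colimit_jointly_epi[OF _ _ c])
    show "category (full_subcategory C S)" using class_category_full_subcategory[OF C] by (rule class_categoryD)
    show "is_functor I (full_subcategory C S) D" using D by (simp add: filtered_diagram_def)
    show "Comp C u v \<in> hom (full_subcategory C S) A A" "Id C A \<in> hom (full_subcategory C S) A A"
      using Comp_hom[OF cat v(1) u(1)] Id_hom[OF cat AA] A by (simp_all add: hom_full_subcategory)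
    show "Comp (full_subcategory C S) (Comp C u v) (c i) = Comp (full_subcategory C S) (Id C A) (c i)"
      if i: "i \<in> Obj I" for i
      using Comp_assoc[OF cat ci(1)[OF i] v(1) u(1)] u(2)[OF i] v(2)[OF i] Id_Comp[OF cat ci(1)[OF i]] by simp
  qed
  show ?thesis
  proof (rule colimitI[OF cocA])
    fix E d assume "is_cocone I C D E d"
    then obtain w where w: "w \<in> hom C B E" "\<And>i. i \<in> Obj I \<Longrightarrow> Comp C w (b i) = d i"
      using colimit_factor[OF b] by blast
    have "Comp C (Comp C w v) (c i) = d i" if i: "i \<in> Obj I" for i
      using Comp_assoc[OF cat ci(1)[OF i] v(1) w(1)] v(2)[OF i] w(2)[OF i] by simp
    then show "\<exists>u \<in> hom C A E. \<forall>i \<in> Obj I. Comp C u (c i) = d i"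
      using Comp_hom[OF cat v(1) w(1)] by blast
  next
    fix E x y assume x: "x \<in> hom C A E" and y: "y \<in> hom C A E"
      and eq: "\<And>i. i \<in> Obj I \<Longrightarrow> Comp C x (c i) = Comp C y (c i)"
    have "Comp C x u = Comp C y u"
    proof (rule colimit_jointly_epi[OF cat F b Comp_hom[OF cat u(1) x] Comp_hom[OF cat u(1) y]])
      fix i assume i: "i \<in> Obj I"
      show "Comp C (Comp C x u) (b i) = Comp C (Comp C y u) (b i)"
        using Comp_assoc[OF cat ci(2)[OF i] u(1) x] Comp_assoc[OF cat ci(2)[OF i] u(1) y] u(2)[OF i] eq[OF i] by simp
    qed
    then show "x = y"
      using Comp_assoc[OF cat v(1) u(1) x] Comp_assoc[OF cat v(1) u(1) y] uv Comp_Id[OF cat x] Comp_Id[OF cat y] by simp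
  qed
qed

lemma presentable_full_subcategory:
  fixes C :: "('u, 'u) cat"
  assumes C: "class_category C" and \<kappa>: "Cinfinite (\<kappa> :: 'u rel)" and colim: "has_filtered_colimits \<kappa> C"
    and closed: "closed_under_filtered_colimits \<kappa> (full_subcategory C S) C"
    and A: "A \<in> S" "presentable \<kappa> C A"
  shows "presentable \<kappa> (full_subcategory C S) A"
  unfolding presentable_iff_stagewise[OF class_category_full_subcategory[OF C] \<kappa>]
proof (intro conjI allI impI)
  show "A \<in> Obj (full_subcategory C S)" using A by (simp add: presentable_def)
  fix I D K c assume D: "filtered_diagram \<kappa> I (full_subcategory C S) D"
    and K: "is_colimit I (full_subcategory C S) D K c"
  have DC: "filtered_diagram \<kappa> I C D" and DS: "\<forall>i \<in> Obj I. on_obj D i \<in> S"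
    using D filtered_diagram_full_subcategory_iff[OF C] by blast+
  have "K \<in> S" using cocone_obj[OF colimit_cocone[OF K]] by simp
  moreover have "stagewise_hom C A I D K c"
    using A(2) DC colimit_if_colimit_full_subcategory[OF C colim closed D K]
    unfolding presentable_iff_stagewise[OF C \<kappa>] by blast
  ultimately show "stagewise_hom (full_subcategory C S) A I D K c"
    using A(1) DS unfolding stagewise_hom_def by (simp add: hom_full_subcategory)
qed

text \<open>
  The identity of \<open>A\<close> factors through some \<open>D i\<close>, so \<open>A\<close> is a retract of an object presentable in \<open>C\<close>.
\<close>

lemma presentable_if_presentable_full_subcategory:
  fixes C :: "('u, 'u) cat"
  assumes C: "class_category C" and \<kappa>: "Cinfinite (\<kappa> :: 'u rel)"
    and A: "presentable \<kappa> (full_subcategory C S) A"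
    and D: "filtered_diagram \<kappa> I (full_subcategory C S) D" "is_colimit I (full_subcategory C S) D A c"
    and pres: "\<And>i. i \<in> Obj I \<Longrightarrow> presentable \<kappa> C (on_obj D i)"
  shows "presentable \<kappa> C A"
proof -
  let ?S = "full_subcategory C S"
  have CS: "class_category ?S" using class_category_full_subcategory[OF C] .
  have AS: "A \<in> Obj ?S" using A by (simp add: presentable_def)
  have "stagewise_hom ?S A I D A c" using A D unfolding presentable_iff_stagewise[OF CS \<kappa>] by blast
  then obtain i s where i: "i \<in> Obj I" and s: "s \<in> hom ?S A (on_obj D i)" and eq: "Comp ?S (c i) s = Id ?S A"
    using Id_hom[OF class_categoryD(1)[OF CS] AS] unfolding stagewise_hom_def by blast
  have c: "c i \<in> hom ?S (on_obj D i) A" using cocone_hom[OF colimit_cocone[OF D(2)] i] .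
  have "s \<in> hom C A (on_obj D i)" "c i \<in> hom C (on_obj D i) A" using s c by (auto simp: hom_def)
  then show ?thesis using presentable_retract[OF C \<kappa> pres[OF i]] eq by simp
qed

section \<open>The equifier\<close>

lemma equifier_closed_under_filtered_colimits:
  assumes K: "class_category K" and \<phi>: "natural_transformation K L F G \<phi>" and \<psi>: "natural_transformation K L F G \<psi>"
    and F: "preserves_filtered_colimits \<kappa> K L F"
  shows "closed_under_filtered_colimits \<kappa> (equifier K \<phi> \<psi>) K"
  unfolding closed_under_filtered_colimits_def comp_func_inclusion
proof (intro allI impI, elim conjE)
  fix I D A c assume D: "filtered_diagram \<kappa> I (equifier K \<phi> \<psi>) D" and A: "is_colimit I K D A c"
  have FF: "is_functor K L F" and cat: "category L"
    using \<phi> by (auto simp: natural_transformation_def is_functor_def)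
  have DK: "filtered_diagram \<kappa> I K D" and eq: "\<And>i. i \<in> Obj I \<Longrightarrow> \<phi> (on_obj D i) = \<psi> (on_obj D i)"
    using D unfolding equifier_def filtered_diagram_full_subcategory_iff[OF K] by auto
  have FA: "is_colimit I L (comp_func F D) (on_obj F A) (\<lambda>i. on_mor F (c i))"
    using F DK A unfolding preserves_filtered_colimits_def by blast
  note cocA = colimit_cocone[OF A]
  have AK: "A \<in> Obj K" using cocone_obj[OF cocA] .
  have "is_functor I L (comp_func F D)" using DK FF is_functor_comp by (auto simp: filtered_diagram_def)
  then have "\<phi> A = \<psi> A"
  proof (rule colimit_jointly_epi[OF cat _ FA])
    show "\<phi> A \<in> hom L (on_obj F A) (on_obj G A)" "\<psi> A \<in> hom L (on_obj F A) (on_obj G A)"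
      using \<phi> \<psi> AK by (auto simp: natural_transformation_def)
    fix i assume i: "i \<in> Obj I"
    have "c i \<in> Mor K" "Dom K (c i) = on_obj D i" "Cod K (c i) = A" using homD[OF cocone_hom[OF cocA i]] by auto
    then show "Comp L (\<phi> A) (on_mor F (c i)) = Comp L (\<psi> A) (on_mor F (c i))"
      using \<phi> \<psi> eq[OF i] unfolding natural_transformation_def by metis
  qed
  then show "A \<in> Obj (equifier K \<phi> \<psi>)" using AK by (simp add: equifier_def)
qed

text \<open>
  This raises the degree of accessibility of \<open>F\<close> from \<open>\<kappa>\<close> to \<open>\<mu>\<close>. The refined diagram
  consists of colimits of fewer than \<open>\<mu>\<close> \<open>\<kappa>\<close>-presentable objects. Their shapes are still \<open>\<kappa>\<close>-filtered, so
  \<open>F\<close> preserves these colimits and their images are colimits of the same kind.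
\<close>

lemma colimit_of_presentables_with_presentable_images:
  fixes \<kappa> \<mu> :: "'u rel" and K L :: "('u, 'u) cat"
  assumes universe: "inaccessible |UNIV :: 'u set|"
    and \<kappa>: "regular_cardinal \<kappa>" and \<mu>: "regular_cardinal \<mu>" and sharp: "sharply_below \<kappa> \<mu>"
    and F: "strongly_class_accessible_functor_at \<kappa> K L F" and X: "X \<in> Obj K"
  shows "\<exists>P E d. filtered_diagram \<mu> P K E \<and> is_colimit P K E X d \<and>
    (\<forall>p \<in> Obj P. presentable \<mu> K (on_obj E p) \<and> presentable \<mu> L (on_obj F (on_obj E p)))"
proof -
  note regular_cardinalD[OF \<kappa>] and regular_cardinalD[OF \<mu>]
  have le: "\<kappa> \<le>o \<mu>" using sharp ordLess_imp_ordLeq by (auto simp: sharply_below_def)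
  have K: "class_accessible_at \<kappa> K" and L: "class_accessible_at \<kappa> L" and FF: "is_functor K L F"
    and Fcol: "preserves_filtered_colimits \<kappa> K L F" and Fpres: "preserves_presentable \<kappa> K L F"
    using F by (auto simp: strongly_class_accessible_functor_at_def class_accessible_functor_at_def)
  have cK: "class_category K" "has_filtered_colimits \<kappa> K" and cL: "class_category L"
    using K L by (auto simp: class_accessible_at_def)
  obtain I D c where D: "filtered_diagram \<kappa> I K D" and pres: "\<And>i. i \<in> Obj I \<Longrightarrow> presentable \<kappa> K (on_obj D i)"
    and c: "is_colimit I K D X c"
    using K X unfolding class_accessible_at_def by meson
  have DF: "is_functor I K D" using D by (simp add: filtered_diagram_def)
  have "\<exists>P E d. filtered_diagram \<mu> P K E \<and> is_colimit P K E X d \<and>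
    (\<forall>p \<in> Obj P. \<exists>M b. |M| <o \<mu> \<and> saturated \<kappa> I M \<and> id ` M \<subseteq> M \<and>
      is_colimit (arrow_subcategory I M) K D (on_obj E p) b)"
    by (rule refine_filtered_colimit[OF universe \<kappa> \<mu> sharp class_categoryD(1)[OF cK(1)] cK(2) D c]) simp
  then obtain P E d where E: "filtered_diagram \<mu> P K E" "is_colimit P K E X d"
    and Ep: "\<And>p. p \<in> Obj P \<Longrightarrow> \<exists>M b. |M| <o \<mu> \<and> saturated \<kappa> I M \<and> id ` M \<subseteq> M \<and>
      is_colimit (arrow_subcategory I M) K D (on_obj E p) b" by (elim exE conjE) (rule that, auto)
  have "presentable \<mu> K (on_obj E p) \<and> presentable \<mu> L (on_obj F (on_obj E p))" if p: "p \<in> Obj P" for p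
  proof -
    obtain M b where M: "|M| <o \<mu>" "saturated \<kappa> I M" and b: "is_colimit (arrow_subcategory I M) K D (on_obj E p) b"
      using Ep[OF p] by blast
    let ?J = "arrow_subcategory I M"
    have DJ: "is_functor ?J K D" using functor_arrow_subcategory[OF DF M(2)] .
    have J: "|Mor ?J| <o \<mu>" using M(1) by simp
    have "presentable \<mu> K (on_obj D i)" "presentable \<mu> L (on_obj (comp_func F D) i)" if "i \<in> Obj ?J" for i
      using that pres[of i] presentable_mono[OF le] Fpres by (auto simp: preserves_presentable_def)
    moreover have "is_colimit ?J L (comp_func F D) (on_obj F (on_obj E p)) (\<lambda>i. on_mor F (b i))"
      using Fcol b filtered_diagram_arrow_subcategory[OF D M(2)] unfolding preserves_filtered_colimits_def by blast
    ultimately show ?thesis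
      using presentable_small_colimit[OF cK(1) \<open>Cinfinite \<mu>\<close> DJ J _ b]
        presentable_small_colimit[OF cL \<open>Cinfinite \<mu>\<close> is_functor_comp[OF DJ FF] J] by blast
  qed
  then show ?thesis using E by blast
qed

text \<open>
  The refinement is taken along the operation that adds to each arrow out of \<open>i\<close> an arrow \<open>u i\<close> after
  which \<open>\<phi>\<close> and \<open>\<psi>\<close> agree at \<open>D i\<close>. Such \<open>u i\<close> exists because \<open>\<phi>\<close> and \<open>\<psi>\<close> agree at \<open>X\<close>, the object
  \<open>F (D i)\<close> is presentable and \<open>G X\<close> is the colimit of the \<open>G (D i)\<close>. The colimit of a subdiagram closed
  under \<open>u\<close> then lies in the equifier: at each of its stages, the path to the colimit passes through some
  \<open>u i\<close>.
\<close>

lemma equifier_object_colimit_of_presentables: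
  fixes \<kappa> \<mu> :: "'u rel" and K L :: "('u, 'u) cat"
  assumes universe: "inaccessible |UNIV :: 'u set|"
    and \<kappa>: "regular_cardinal \<kappa>" and \<mu>: "regular_cardinal \<mu>" and sharp: "sharply_below \<kappa> \<mu>"
    and K: "class_category K" "has_filtered_colimits \<kappa> K" and L: "class_category L"
    and F: "preserves_filtered_colimits \<kappa> K L F" and G: "preserves_filtered_colimits \<kappa> K L G"
    and \<phi>: "natural_transformation K L F G \<phi>" and \<psi>: "natural_transformation K L F G \<psi>"
    and X: "\<phi> X = \<psi> X"
    and D: "filtered_diagram \<kappa> I K D" and c: "is_colimit I K D X c"
    and pres: "\<And>i. i \<in> Obj I \<Longrightarrow> presentable \<kappa> K (on_obj D i) \<and> presentable \<kappa> L (on_obj F (on_obj D i))"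
  shows "\<exists>P E d. filtered_diagram \<mu> P (equifier K \<phi> \<psi>) E \<and> is_colimit P (equifier K \<phi> \<psi>) E X d \<and>
    (\<forall>p \<in> Obj P. presentable \<mu> K (on_obj E p))"
proof -
  note regular_cardinalD[OF \<kappa>] and regular_cardinalD[OF \<mu>]
  have le: "\<kappa> \<le>o \<mu>" using sharp ordLess_imp_ordLeq by (auto simp: sharply_below_def)
  have catK: "category K" and catL: "category L" using K(1) L by (auto dest: class_categoryD)
  have DF: "is_functor I K D" and catI: "category I"
    using D by (auto simp: filtered_diagram_def is_functor_def)
  have FF: "is_functor K L F" and GG: "is_functor K L G" using \<phi> by (auto simp: natural_transformation_def)
  have comp: "\<phi> A \<in> hom L (on_obj F A) (on_obj G A)" "\<psi> A \<in> hom L (on_obj F A) (on_obj G A)" if "A \<in> Obj K" for A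
    using \<phi> \<psi> that by (auto simp: natural_transformation_def)
  have nat: "Comp L (\<phi> B) (on_mor F f) = Comp L (on_mor G f) (\<phi> A)"
    "Comp L (\<psi> B) (on_mor F f) = Comp L (on_mor G f) (\<psi> A)" if "f \<in> hom K A B" for A B f
    using \<phi> \<psi> homD[OF that] by (auto simp: natural_transformation_def)
  have Di: "on_obj D i \<in> Obj K" if "i \<in> Obj I" for i using DF that by (simp add: is_functor_def)
  have "\<exists>j. \<exists>u \<in> hom I i j. Comp L (on_mor G (on_mor D u)) (\<phi> (on_obj D i)) = Comp L (on_mor G (on_mor D u)) (\<psi> (on_obj D i))"
    if i: "i \<in> Obj I" for i
  proof -
    have "filtered_diagram \<kappa> I L (comp_func G D)" using D is_functor_comp[OF DF GG] by (simp add: filtered_diagram_def)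
    moreover have "is_colimit I L (comp_func G D) (on_obj G X) (\<lambda>i. on_mor G (c i))"
      using G D c unfolding preserves_filtered_colimits_def by blast
    ultimately have "stagewise_hom L (on_obj F (on_obj D i)) I (comp_func G D) (on_obj G X) (\<lambda>i. on_mor G (c i))"
      using pres[OF i] unfolding presentable_iff_stagewise[OF L \<open>Cinfinite \<kappa>\<close>] by blast
    moreover have "Comp L (on_mor G (c i)) (\<phi> (on_obj D i)) = Comp L (on_mor G (c i)) (\<psi> (on_obj D i))"
      using nat[OF cocone_hom[OF colimit_cocone[OF c] i]] X by simp
    ultimately show ?thesis using i comp[OF Di[OF i]] by (simp add: stagewise_hom_def)
  qed
  then obtain t u where u: "\<And>i. i \<in> Obj I \<Longrightarrow> u i \<in> hom I i (t i)"
    and eq: "\<And>i. i \<in> Obj I \<Longrightarrow>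
      Comp L (on_mor G (on_mor D (u i))) (\<phi> (on_obj D i)) = Comp L (on_mor G (on_mor D (u i))) (\<psi> (on_obj D i))"
    by metis
  have h: "u (Dom I f) \<in> Mor I" if "f \<in> Mor I" for f
    using homD(1)[OF u] catI that by (simp add: category_def)
  have "\<exists>P E d. filtered_diagram \<mu> P K E \<and> is_colimit P K E X d \<and>
    (\<forall>p \<in> Obj P. \<exists>M b. |M| <o \<mu> \<and> saturated \<kappa> I M \<and> (\<lambda>f. u (Dom I f)) ` M \<subseteq> M \<and>
      is_colimit (arrow_subcategory I M) K D (on_obj E p) b)"
    by (rule refine_filtered_colimit[OF universe \<kappa> \<mu> sharp catK K(2) D c]) (rule h)
  then obtain P E d where E: "filtered_diagram \<mu> P K E" "is_colimit P K E X d"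
    and Ep: "\<And>p. p \<in> Obj P \<Longrightarrow> \<exists>M b. |M| <o \<mu> \<and> saturated \<kappa> I M \<and> (\<lambda>f. u (Dom I f)) ` M \<subseteq> M \<and>
      is_colimit (arrow_subcategory I M) K D (on_obj E p) b" by (elim exE conjE) (rule that, auto)
  have stage: "presentable \<mu> K (on_obj E p) \<and> \<phi> (on_obj E p) = \<psi> (on_obj E p)" if p: "p \<in> Obj P" for p
  proof
    obtain M b where M: "|M| <o \<mu>" "saturated \<kappa> I M" "\<And>f. f \<in> M \<Longrightarrow> u (Dom I f) \<in> M"
      and b: "is_colimit (arrow_subcategory I M) K D (on_obj E p) b"
      using Ep[OF p] by blast
    let ?J = "arrow_subcategory I M" and ?B = "on_obj E p"
    have DJ: "is_functor ?J K D" using functor_arrow_subcategory[OF DF M(2)] .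
    have J: "|Mor ?J| <o \<mu>" using M(1) by simp
    have "presentable \<mu> K (on_obj D i)" if "i \<in> Obj ?J" for i
      using that pres[of i] presentable_mono[OF le] by auto
    then show "presentable \<mu> K ?B" by (rule presentable_small_colimit[OF K(1) \<open>Cinfinite \<mu>\<close> DJ J _ b])
    have FB: "is_colimit ?J L (comp_func F D) (on_obj F ?B) (\<lambda>i. on_mor F (b i))"
      using F b filtered_diagram_arrow_subcategory[OF D M(2)] unfolding preserves_filtered_colimits_def by blast
    have BK: "?B \<in> Obj K" using cocone_obj[OF colimit_cocone[OF b]] .
    show "\<phi> ?B = \<psi> ?B"
    proof (rule colimit_jointly_epi[OF catL is_functor_comp[OF DJ FF] FB comp[OF BK]])
      fix i assume iJ: "i \<in> Obj ?J"
      then have i: "i \<in> Obj I" and "Id I i \<in> M" by auto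
      \<comment> \<open>The operation is indexed by arrows; the identity of \<open>i\<close> stands for \<open>i\<close>.\<close>
      then have uM: "u i \<in> M" using M(3)[of "Id I i"] homD(2)[OF Id_hom[OF catI i]] by simp
      have uJ: "u i \<in> hom ?J i (t i)" using uM homD[OF u[OF i]] by (simp add: hom_def)
      have tJ: "t i \<in> Obj ?J" using hom_obj(2)[OF category_arrow_subcategory[OF catI M(2)] uJ] .
      note bi = cocone_hom[OF colimit_cocone[OF b] iJ] and bt = cocone_hom[OF colimit_cocone[OF b] tJ]
      note Du = functor_hom[OF DJ uJ]
      have "on_mor G (b i) = Comp L (on_mor G (b (t i))) (on_mor G (on_mor D (u i)))"
        using cocone_commute[OF colimit_cocone[OF b] uJ] functor_Comp[OF GG Du bt] by simp
      then have "Comp L (on_mor G (b i)) (\<phi> (on_obj D i)) = Comp L (on_mor G (b i)) (\<psi> (on_obj D i))"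
        using Comp_assoc[OF catL comp(1)[OF Di[OF i]] functor_hom[OF GG Du] functor_hom[OF GG bt]]
          Comp_assoc[OF catL comp(2)[OF Di[OF i]] functor_hom[OF GG Du] functor_hom[OF GG bt]] eq[OF i] by simp
      then show "Comp L (\<phi> ?B) (on_mor F (b i)) = Comp L (\<psi> ?B) (on_mor F (b i))"
        using nat[OF bi] by simp
    qed
  qed
  have XK: "X \<in> Obj K" using cocone_obj[OF colimit_cocone[OF c]] .
  have EK: "on_obj E p \<in> Obj K" if "p \<in> Obj P" for p
    using stage[OF that] by (simp add: presentable_def)
  have ES: "\<forall>p \<in> Obj P. on_obj E p \<in> {A \<in> Obj K. \<phi> A = \<psi> A}" using EK stage by blast
  have "filtered_diagram \<mu> P (equifier K \<phi> \<psi>) E"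
    unfolding equifier_def filtered_diagram_full_subcategory_iff[OF K(1)] using E(1) ES by blast
  moreover have "is_colimit P (equifier K \<phi> \<psi>) E X d"
    unfolding equifier_def using colimit_full_subcategory_if_colimit[OF ES _ E(2)] XK X by blast
  ultimately show ?thesis using stage by blast
qed

theorem proposition3p6:
  fixes K L :: "('u, 'u) cat"
    and F G :: "('u, 'u, 'u, 'u) func"
    and \<phi> \<psi> :: "'u \<Rightarrow> 'u"
  assumes universe: "inaccessible |UNIV :: 'u set|"
    and F: "strongly_class_accessible_functor K L F"
    and G: "strongly_class_accessible_functor K L G"
    and \<phi>: "natural_transformation K L F G \<phi>"
    and \<psi>: "natural_transformation K L F G \<psi>"
  shows "class_accessible (equifier K \<phi> \<psi>) \<and> strongly_accessibly_embedded (equifier K \<phi> \<psi>) K"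
proof -
  let ?E = "equifier K \<phi> \<psi>" and ?S = "{A \<in> Obj K. \<phi> A = \<psi> A}"
  obtain \<kappa> where \<kappa>: "regular_cardinal \<kappa>" and F\<kappa>: "strongly_class_accessible_functor_at \<kappa> K L F"
    using F by (auto simp: strongly_class_accessible_functor_def)
  obtain \<kappa>' where \<kappa>': "regular_cardinal \<kappa>'" and G\<kappa>': "strongly_class_accessible_functor_at \<kappa>' K L G"
    using G by (auto simp: strongly_class_accessible_functor_def)
  obtain \<mu> where \<mu>: "regular_cardinal \<mu>" "sharply_below \<kappa> \<mu>" "\<kappa>' <o \<mu>"
    using exists_sharply_above[OF universe \<kappa> \<kappa>'] by blast
  obtain \<nu> where \<nu>: "regular_cardinal \<nu>" "sharply_below \<mu> \<nu>"
    using exists_sharply_above[OF universe \<mu>(1) \<mu>(1)] by blast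
  have le: "\<kappa> \<le>o \<mu>" "\<kappa>' \<le>o \<mu>" "\<mu> \<le>o \<nu>"
    using \<mu> \<nu> ordLess_imp_ordLeq by (auto simp: sharply_below_def)
  have K: "class_category K" "has_filtered_colimits \<mu> K" and L: "class_category L"
    using F\<kappa> has_filtered_colimits_mono[OF le(1)]
    by (auto simp: strongly_class_accessible_functor_at_def class_accessible_functor_at_def class_accessible_at_def)
  have pres: "preserves_filtered_colimits \<mu> K L F" "preserves_filtered_colimits \<mu> K L G"
    using F\<kappa> G\<kappa>' preserves_filtered_colimits_mono[OF le(1)] preserves_filtered_colimits_mono[OF le(2)]
    by (auto simp: strongly_class_accessible_functor_at_def class_accessible_functor_at_def)
  note K\<nu> = has_filtered_colimits_mono[OF le(3) K(2)]
  note Cinf = regular_cardinalD(1)[OF \<nu>(1)]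
  have E_class: "class_category ?E" unfolding equifier_def using class_category_full_subcategory[OF K(1)] .
  have closed: "closed_under_filtered_colimits \<nu> ?E K"
    using equifier_closed_under_filtered_colimits[OF K(1) \<phi> \<psi> preserves_filtered_colimits_mono[OF le(3) pres(1)]] .
  have decompose: "\<exists>P D d. filtered_diagram \<nu> P ?E D \<and> is_colimit P ?E D X d \<and>
      (\<forall>p \<in> Obj P. presentable \<nu> K (on_obj D p))" if X: "X \<in> Obj ?E" for X
  proof -
    have XK: "X \<in> Obj K" "\<phi> X = \<psi> X" using X by (auto simp: equifier_def)
    obtain I D c where "filtered_diagram \<mu> I K D" "is_colimit I K D X c"
      "\<And>i. i \<in> Obj I \<Longrightarrow> presentable \<mu> K (on_obj D i) \<and> presentable \<mu> L (on_obj F (on_obj D i))"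
      using colimit_of_presentables_with_presentable_images[OF universe \<kappa> \<mu>(1,2) F\<kappa> XK(1)] by blast
    from equifier_object_colimit_of_presentables[OF universe \<mu>(1) \<nu> K L pres \<phi> \<psi> XK(2) this] show ?thesis .
  qed
  have E_colim: "has_filtered_colimits \<nu> ?E"
    unfolding has_filtered_colimits_def
  proof (intro allI impI)
    fix I D assume D: "filtered_diagram \<nu> I ?E D"
    then have DK: "filtered_diagram \<nu> I K D" and DS: "\<forall>i \<in> Obj I. on_obj D i \<in> ?S"
      unfolding equifier_def filtered_diagram_full_subcategory_iff[OF K(1)] by blast+
    obtain A c where A: "is_colimit I K D A c" using K\<nu> DK unfolding has_filtered_colimits_def by blast
    then have "A \<in> Obj ?E" using closed D unfolding closed_under_filtered_colimits_def by auto
    then have "A \<in> ?S" by (simp add: equifier_def)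
    then show "\<exists>A c. is_colimit I ?E D A c"
      unfolding equifier_def using colimit_full_subcategory_if_colimit[OF DS _ A] by blast
  qed
  have to_E: "presentable \<nu> ?E A" if "A \<in> Obj ?E" "presentable \<nu> K A" for A
    unfolding equifier_def
    by (rule presentable_full_subcategory[OF K(1) Cinf K\<nu> closed[unfolded equifier_def]])
      (use that in \<open>auto simp: equifier_def\<close>)
  have to_K: "presentable \<nu> K A" if A: "presentable \<nu> ?E A" for A
  proof -
    have "A \<in> Obj ?E" using A by (simp add: presentable_def)
    then obtain P D d where "filtered_diagram \<nu> P ?E D" "is_colimit P ?E D A d"
      "\<And>p. p \<in> Obj P \<Longrightarrow> presentable \<nu> K (on_obj D p)" using decompose by blast
    with A show ?thesis
      unfolding equifier_def by (rule presentable_if_presentable_full_subcategory[OF K(1) Cinf])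
  qed
  have "class_accessible_at \<nu> ?E"
    unfolding class_accessible_at_def
  proof (intro conjI E_class E_colim exI[of _ "{A \<in> Obj ?E. presentable \<nu> K A}"] ballI)
    fix X assume "X \<in> Obj ?E"
    then obtain P D d where D: "filtered_diagram \<nu> P ?E D" "is_colimit P ?E D X d"
      "\<And>p. p \<in> Obj P \<Longrightarrow> presentable \<nu> K (on_obj D p)" using decompose by blast
    moreover have "on_obj D p \<in> Obj ?E" if "p \<in> Obj P" for p
      using D(1) that by (simp add: filtered_diagram_def is_functor_def)
    ultimately show "\<exists>I D c. filtered_diagram \<nu> I ?E D \<and>
        (\<forall>i \<in> Obj I. on_obj D i \<in> {A \<in> Obj ?E. presentable \<nu> K A}) \<and> is_colimit I ?E D X c" by blast
  qed (use to_E in blast)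
  moreover have "is_full_subcategory ?E K"
    unfolding is_full_subcategory_def equifier_def by (intro exI[of _ ?S]) simp
  moreover have "preserves_presentable \<nu> ?E K inclusion"
    using to_K by (simp add: preserves_presentable_def inclusion_def)
  ultimately show ?thesis
    using \<nu>(1) closed unfolding class_accessible_def strongly_accessibly_embedded_def by blast
qed

end
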